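(* Let $A$ be a polynomial algebra over a field $\mathbb F$ of characteristic $0$. Any (formal) deformation of $A$ is equivalent to a (formal) deformation whose cochains are differential operators. Likewise, any (formal) deformation quantization of $A$ is equivalent to a (formal) deformation quantization whose cochains are differential operators.
   Context: $A=\mathbb F[x_i]_{i\in\mathcal I}$ with product $\pi$. A formal deformation of $A$ is an associative $\mathbb F[[h]]$-bilinear product $\pi_\star:A[[h]]\times A[[h]]\to A[[h]]$ with $\pi_\star(p,q)=pq \bmod h$ for $p,q\in A$; it is given by $\pi_\star=\pi+h\pi_1+h^2\pi_2+\cdots$ with $\mathbb F$-bilinear cochains $\pi_i:A\times A\to A$. It is a deformation quantization if $\pi_k$ is symmetric for $k$ even and antisymmetric for $k$ odd. Two deformations $\pi_\star,\pi_\star'$ are equivalent if there is an $\mathbb F[[h]]$-linear map $F:A[[h]]\to A[[h]]$ with $F(p)=p\bmod h$ for $p\in A$ and $F(\pi_\star(p,q))=\pi'_\star(F(p),F(q))$ for $p,q\in A$. For a multi-index $I=(i_1,\dots,i_m)$ put $|I|=m$ and $\partial^I=\frac{\partial}{\partial x_{i_1}}\cdots\frac{\partial}{\partial x_{i_m}}$. Every $n$-cochain ($n$-linear map $A^n\to A$) can be written uniquely as a formal sum $\varphi=\sum_{I_1,\dots,I_n}\varphi_{I_1,\dots,I_n}\,\partial^{I_1}\otimes\cdots\otimes\partial^{I_n}$ over non-decreasing multi-indices (for a fixed total order on $\mathcal I$), with $\varphi_{I_1,\dots,I_n}\in A$, where $(\partial^{I_1}\otimes\cdots\otimes\partial^{I_n})(p_1,\dots,p_n)=\partial^{I_1}(p_1)\cdots\partial^{I_n}(p_n)$.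 It is called a (finite order) differential operator if there is a bound on $|I_1|+\cdots+|I_n|$ over all non-zero coefficients $\varphi_{I_1,\dots,I_n}$. *)

theory Defs
  imports
    "HOL-Library.Poly_Mapping"
    "HOL-Library.Multiset"
    "HOL-Computational_Algebra.Formal_Power_Series"
begin

unbundle fps_syntax

section \<open>Polynomial algebras\<close>

text \<open>
  Polynomials are finitely supported maps from monomials (exponent vectors) to coefficients, with
  the convolution product of \<^theory>\<open>HOL-Library.Poly_Mapping\<close>.
  The variables are indexed by an arbitrary set \<open>I\<close>, possibly infinite or empty; \<open>polys I\<close> is the
  carrier of the algebra \<open>A = F[x_i | i \<in> I]\<close>. All notions below are relative to this carrier:
  values of maps outside of it play no role.
\<close>

type_synonym ('i, 'f) mpoly = "('i \<Rightarrow>\<^sub>0 nat) \<Rightarrow>\<^sub>0 'f"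

definition polys :: "'i set \<Rightarrow> ('i, 'f::field) mpoly set" where
  "polys I = {p. \<forall>m \<in> Poly_Mapping.keys p. Poly_Mapping.keys m \<subseteq> I}"

definition const_poly :: "'f::field \<Rightarrow> ('i, 'f) mpoly" where
  "const_poly c = Poly_Mapping.single 0 c"

text \<open>The derivative is \<open>c x^m \<mapsto> m_i c x^(m - e_i)\<close>, extended linearly. The truncated subtraction
  is harmless, as the coefficient vanishes if \<open>m_i = 0\<close>.\<close>

definition partial_deriv :: "'i \<Rightarrow> ('i, 'f::field) mpoly \<Rightarrow> ('i, 'f) mpoly" where
  "partial_deriv i p = (\<Sum>m \<in> Poly_Mapping.keys p.
     Poly_Mapping.single (m - Poly_Mapping.single i 1)
       (of_nat (Poly_Mapping.lookup m i) * Poly_Mapping.lookup p m))"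

text \<open>
  A non-decreasing multi-index \<open>(i_1, \<dots>, i_m)\<close> with respect to a total order on the index set is
  the same as the finite multiset \<open>{#i_1, \<dots>, i_m#}\<close>; its length is the size of the multiset.
\<close>

definition multi_deriv :: "'i multiset \<Rightarrow> ('i, 'f::field) mpoly \<Rightarrow> ('i, 'f) mpoly" where
  "multi_deriv M p = fold_mset partial_deriv p M"

lemma lookup_partial_deriv:
  "Poly_Mapping.lookup (partial_deriv i p) m =
     of_nat (Suc (Poly_Mapping.lookup m i)) * Poly_Mapping.lookup p (m + Poly_Mapping.single i 1)"
proof -
  let ?e = "Poly_Mapping.single i (1::nat)"
  have "(of_nat (Poly_Mapping.lookup n i) * Poly_Mapping.lookup p n when n - ?e = m) =
      (of_nat (Suc (Poly_Mapping.lookup m i)) * Poly_Mapping.lookup p (m + ?e) when n = m + ?e)" for n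
  proof (cases "Poly_Mapping.lookup n i = 0")
    case True
    then have "n \<noteq> m + ?e" by (auto simp: lookup_add)
    with True show ?thesis by (simp add: when_def)
  next
    case False
    have "n = n - ?e + ?e"
      by (rule poly_mapping_eqI) (use False in \<open>auto simp: lookup_add lookup_minus lookup_single when_def\<close>)
    then have "n - ?e = m \<longleftrightarrow> n = m + ?e" by auto
    then show ?thesis by (auto simp: when_def lookup_add)
  qed
  then have "Poly_Mapping.lookup (partial_deriv i p) m =
      (\<Sum>n \<in> Poly_Mapping.keys p.
        of_nat (Suc (Poly_Mapping.lookup m i)) * Poly_Mapping.lookup p (m + ?e) when n = m + ?e)"
    by (simp add: partial_deriv_def lookup_sum lookup_single)
  also have "\<dots> = of_nat (Suc (Poly_Mapping.lookup m i)) * Poly_Mapping.lookup p (m + ?e)"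
    by (auto simp: when_def in_keys_iff)
  finally show ?thesis .
qed

lemma partial_deriv_commute: "partial_deriv i (partial_deriv j p) = partial_deriv j (partial_deriv i p)"
  by (rule poly_mapping_eqI)
     (auto simp: lookup_partial_deriv lookup_add lookup_single when_def ac_simps)

interpretation partial_deriv: comp_fun_commute partial_deriv
  by standard (auto simp: partial_deriv_commute)

lemma multi_deriv_empty [simp]: "multi_deriv {#} p = p"
  by (simp add: multi_deriv_def)

lemma multi_deriv_add_mset [simp]:
  "multi_deriv (add_mset i M) p = partial_deriv i (multi_deriv M p)"
  by (simp add: multi_deriv_def)

lemma lookup_multi_deriv_nonzero:
  assumes "Poly_Mapping.lookup (multi_deriv M p) m \<noteq> 0"
  shows "\<exists>n \<in> Poly_Mapping.keys p. \<forall>i. Poly_Mapping.lookup n i = Poly_Mapping.lookup m i + count M i"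
  using assms
proof (induction M arbitrary: m)
  case empty
  then show ?case by (intro bexI[of _ m]) (auto simp: in_keys_iff)
next
  case (add j M)
  then have "Poly_Mapping.lookup (multi_deriv M p) (m + Poly_Mapping.single j 1) \<noteq> 0"
    by (auto simp: lookup_partial_deriv)
  from add.IH[OF this] show ?case
    by (rule bexE) (rule bexI, auto simp: lookup_add lookup_single when_def)
qed

text \<open>Only finitely many higher derivatives of a polynomial are non-zero, even for infinitely many
  variables. Hence the formal sums below are finite on each pair of arguments, and
  \<^const>\<open>Sum_any\<close> does not fall back to its default value.\<close>

lemma finite_multi_deriv_nonzero: "finite {M. multi_deriv M p \<noteq> 0}"
proof -
  define N where "N n = (\<Sum>i \<in> Poly_Mapping.keys n. replicate_mset (Poly_Mapping.lookup n i) i)"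
    for n :: "'a \<Rightarrow>\<^sub>0 nat"
  have count_N: "count (N n) i = Poly_Mapping.lookup n i" for n i
    by (auto simp: N_def count_sum in_keys_iff)
  have "{M. multi_deriv M p \<noteq> 0} \<subseteq> (\<Union>n \<in> Poly_Mapping.keys p. {M. M \<subseteq># N n})"
  proof
    fix M assume "M \<in> {M. multi_deriv M p \<noteq> 0}"
    then obtain m where "Poly_Mapping.lookup (multi_deriv M p) m \<noteq> 0"
      by (auto simp: poly_mapping_eq_iff fun_eq_iff)
    from lookup_multi_deriv_nonzero[OF this]
    obtain n where n: "n \<in> Poly_Mapping.keys p"
      and "\<forall>i. Poly_Mapping.lookup n i = Poly_Mapping.lookup m i + count M i" by blast
    then have "M \<subseteq># N n" by (simp add: subseteq_mset_def count_N)
    with n show "M \<in> (\<Union>n \<in> Poly_Mapping.keys p. {M. M \<subseteq># N n})" by blast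
  qed
  moreover have "finite {M. M \<subseteq># K}" for K :: "'a multiset"
  proof (rule finite_subset)
    show "{M. M \<subseteq># K} \<subseteq> mset ` {xs. set xs \<subseteq> set_mset K \<and> length xs \<le> size K}"
    proof
      fix M assume "M \<in> {M. M \<subseteq># K}"
      moreover obtain xs where "mset xs = M" using ex_mset by blast
      ultimately show "M \<in> mset ` {xs. set xs \<subseteq> set_mset K \<and> length xs \<le> size K}"
        by (intro image_eqI[of _ _ xs]) (auto dest: size_mset_mono mset_subset_eqD)
    qed
    show "finite (mset ` {xs. set xs \<subseteq> set_mset K \<and> length xs \<le> size K})"
      by (intro finite_imageI finite_lists_length_le) simp
  qed
  ultimately show ?thesis
    by (meson finite_UN_I finite_keys finite_subset)
qed

text \<open>
  Finite order differential operators among the 2-cochains: \<open>\<phi> = \<Sum>\<^sub>J\<^sub>,\<^sub>K c J K \<partial>\<^sup>J \<otimes> \<partial>\<^sup>K\<close> with coefficients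
  in \<open>A\<close>, where \<open>|J| + |K|\<close> is bounded over all non-zero coefficients. The sum may have infinitely
  many non-zero coefficients if \<open>I\<close> is infinite.
\<close>

definition differential_operator2 ::
    "'i set \<Rightarrow> (('i, 'f::field) mpoly \<Rightarrow> ('i, 'f) mpoly \<Rightarrow> ('i, 'f) mpoly) \<Rightarrow> bool" where
  "differential_operator2 I \<phi> \<longleftrightarrow> (\<exists>c :: 'i multiset \<Rightarrow> 'i multiset \<Rightarrow> ('i, 'f) mpoly.
     (\<forall>J K. c J K \<in> polys I) \<and>
     (\<forall>J K. c J K \<noteq> 0 \<longrightarrow> set_mset J \<subseteq> I \<and> set_mset K \<subseteq> I) \<and>
     (\<forall>p \<in> polys I. \<forall>q \<in> polys I.
        \<phi> p q = Sum_any (\<lambda>(J, K). c J K * multi_deriv J p * multi_deriv K q)) \<and>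
     (\<exists>d. \<forall>J K. c J K \<noteq> 0 \<longrightarrow> size J + size K \<le> d))"


section \<open>Formal deformations\<close>

text \<open>\<open>A[[h]]\<close> consists of the power series in \<open>h = fps_X\<close> with coefficients in \<open>A\<close>.\<close>

definition poly_series :: "'i set \<Rightarrow> ('i, 'f::field) mpoly fps set" where
  "poly_series I = {P. \<forall>n. P $ n \<in> polys I}"

definition scale_series :: "'f::field fps \<Rightarrow> ('i, 'f) mpoly fps \<Rightarrow> ('i, 'f) mpoly fps" where
  "scale_series a P = Abs_fps (\<lambda>n. const_poly (a $ n)) * P"

definition series_linear ::
    "'i set \<Rightarrow> (('i, 'f::field) mpoly fps \<Rightarrow> ('i, 'f) mpoly fps) \<Rightarrow> bool" where
  "series_linear I F \<longleftrightarrow>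
     (\<forall>P \<in> poly_series I. F P \<in> poly_series I) \<and>
     (\<forall>P \<in> poly_series I. \<forall>Q \<in> poly_series I. F (P + Q) = F P + F Q) \<and>
     (\<forall>a. \<forall>P \<in> poly_series I. F (scale_series a P) = scale_series a (F P))"

definition series_bilinear ::
    "'i set \<Rightarrow> (('i, 'f::field) mpoly fps \<Rightarrow> ('i, 'f) mpoly fps \<Rightarrow> ('i, 'f) mpoly fps) \<Rightarrow> bool" where
  "series_bilinear I star \<longleftrightarrow>
     (\<forall>P \<in> poly_series I. series_linear I (star P)) \<and>
     (\<forall>Q \<in> poly_series I. series_linear I (\<lambda>P. star P Q))"

definition formal_deformation ::
    "'i set \<Rightarrow> (('i, 'f::field) mpoly fps \<Rightarrow> ('i, 'f) mpoly fps \<Rightarrow> ('i, 'f) mpoly fps) \<Rightarrow> bool" where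
  "formal_deformation I star \<longleftrightarrow>
     series_bilinear I star \<and>
     (\<forall>P \<in> poly_series I. \<forall>Q \<in> poly_series I. \<forall>R \<in> poly_series I.
        star (star P Q) R = star P (star Q R)) \<and>
     (\<forall>p \<in> polys I. \<forall>q \<in> polys I. star (fps_const p) (fps_const q) $ 0 = p * q)"

text \<open>
  The cochains \<open>\<pi>\<^sub>k\<close> with \<open>p \<star> q = \<Sum>\<^sub>k h\<^sup>k \<pi>\<^sub>k(p, q)\<close> for \<open>p, q \<in> A\<close>. Their bilinearity over the
  ground field is inherited from the product, and they determine the product on all of
  \<open>A[[h]]\<close>, as an \<open>F[[h]]\<close>-bilinear map is continuous in the \<open>h\<close>-adic topology.
\<close>

definition cochain ::
    "(('i, 'f::field) mpoly fps \<Rightarrow> ('i, 'f) mpoly fps \<Rightarrow> ('i, 'f) mpoly fps) \<Rightarrow>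
     nat \<Rightarrow> ('i, 'f) mpoly \<Rightarrow> ('i, 'f) mpoly \<Rightarrow> ('i, 'f) mpoly" where
  "cochain star k p q = star (fps_const p) (fps_const q) $ k"

definition deformation_quantization ::
    "'i set \<Rightarrow> (('i, 'f::field) mpoly fps \<Rightarrow> ('i, 'f) mpoly fps \<Rightarrow> ('i, 'f) mpoly fps) \<Rightarrow> bool" where
  "deformation_quantization I star \<longleftrightarrow>
     formal_deformation I star \<and>
     (\<forall>k. \<forall>p \<in> polys I. \<forall>q \<in> polys I.
        (even k \<longrightarrow> cochain star k p q = cochain star k q p) \<and>
        (odd k \<longrightarrow> cochain star k p q = - cochain star k q p))"

definition equivalent_deformations ::
    "'i set \<Rightarrow> (('i, 'f::field) mpoly fps \<Rightarrow> ('i, 'f) mpoly fps \<Rightarrow> ('i, 'f) mpoly fps) \<Rightarrow>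
     (('i, 'f) mpoly fps \<Rightarrow> ('i, 'f) mpoly fps \<Rightarrow> ('i, 'f) mpoly fps) \<Rightarrow> bool" where
  "equivalent_deformations I star star' \<longleftrightarrow> (\<exists>F.
     series_linear I F \<and>
     (\<forall>p \<in> polys I. F (fps_const p) $ 0 = p) \<and>
     (\<forall>p \<in> polys I. \<forall>q \<in> polys I.
        F (star (fps_const p) (fps_const q)) = star' (F (fps_const p)) (F (fps_const q))))"

end

theory Submission
  imports Defs
begin

text \<open>
  Pull the product \<open>\<star>\<close> back along the symmetrisation map \<open>S\<close>, which sends a commutative monomial to the
  average of the \<open>\<star>\<close>-products of its factors over all orderings. The resulting product \<open>\<star>'\<close> is
  normalised: \<open>\<Sum>\<^sub>i x\<^sub>i \<star>' \<partial>\<^sub>i p = \<Sum>\<^sub>i x\<^sub>i \<partial>\<^sub>i p\<close>. If \<open>\<star>\<close> is a quantization, then \<open>h \<mapsto> -h\<close> is an anti-automorphism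
  of \<open>\<star>\<close> that commutes with \<open>S\<close>, so \<open>\<star>'\<close> is a quantization as well.

  The cochains \<open>\<pi>\<^sub>k\<close> of a normalised product are differential, by induction on \<open>k\<close>. Put
  \<open>D\<^sub>i = \<pi>\<^sub>k(x\<^sub>i, -)\<close>. By associativity the Hochschild coboundary of \<open>\<pi>\<^sub>k\<close> is differential, hence so is
  \<open>[D\<^sub>i, x\<^sub>j] - [D\<^sub>j, x\<^sub>i]\<close>. Commuting \<open>x\<^sub>j\<close> into the normalisation \<open>\<Sum>\<^sub>i D\<^sub>i \<partial>\<^sub>i = 0\<close> then shows that
  \<open>D\<^sub>j + \<Sum>\<^sub>i [D\<^sub>j, x\<^sub>i] \<partial>\<^sub>i\<close> has bounded order, and in characteristic 0 this forces \<open>D\<^sub>j\<close> to have bounded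
  order. The coboundary equation carries this over from \<open>x\<^sub>j\<close> to arbitrary first arguments.
\<close>

section \<open>Polynomials and derivatives\<close>

definition var :: "'i \<Rightarrow> ('i, 'f::field) mpoly" where
  "var i = Poly_Mapping.single (Poly_Mapping.single i 1) 1"

lemma lookup_const_poly_mult [simp]:
  "Poly_Mapping.lookup (const_poly c * p) m = c * Poly_Mapping.lookup p m"
  unfolding const_poly_def mult_map_scale_conv_mult[symmetric]
  by (simp add: Poly_Mapping.map.rep_eq when_def)

lemma const_poly_simps [simp]:
  "const_poly 0 = 0" "const_poly 1 = 1" "const_poly (a + b) = const_poly a + const_poly b"
  "const_poly (a * b) = const_poly a * const_poly b" "const_poly (- a) = - const_poly a"
  by (simp_all add: const_poly_def single_add mult_single single_uminus)

lemma const_poly_mult_single [simp]: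
  "const_poly c * Poly_Mapping.single m a = Poly_Mapping.single m (c * a)"
  by (simp add: const_poly_def mult_single)

lemma polys_mono: "V \<subseteq> W \<Longrightarrow> polys V \<subseteq> polys W"
  by (auto simp: polys_def)

lemma polys_0 [simp]: "0 \<in> polys V"
  by (simp add: polys_def)

lemma polys_single: "Poly_Mapping.keys m \<subseteq> V \<Longrightarrow> Poly_Mapping.single m c \<in> polys V"
  by (simp add: polys_def)

lemma polys_const [simp]: "const_poly c \<in> polys V"
  by (simp add: const_poly_def polys_single)

lemma polys_1 [simp]: "1 \<in> polys V"
  using polys_const[of 1] by simp

lemma polys_var: "i \<in> V \<Longrightarrow> var i \<in> polys V"
  by (simp add: var_def polys_single)

lemma polys_add: "p \<in> polys V \<Longrightarrow> q \<in> polys V \<Longrightarrow> p + q \<in> polys V"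
  using Poly_Mapping.keys_add[of p q] by (auto simp: polys_def)

lemma polys_diff: "p \<in> polys V \<Longrightarrow> q \<in> polys V \<Longrightarrow> p - q \<in> polys V"
  using keys_diff[of p q] by (auto simp: polys_def)

lemma polys_uminus: "p \<in> polys V \<Longrightarrow> - p \<in> polys V"
  by (auto simp: polys_def)

lemma polys_mult: "p \<in> polys V \<Longrightarrow> q \<in> polys V \<Longrightarrow> p * q \<in> polys V"
  unfolding polys_def mem_Collect_eq
proof
  fix m
  assume p: "\<forall>m \<in> Poly_Mapping.keys p. Poly_Mapping.keys m \<subseteq> V"
    and q: "\<forall>m \<in> Poly_Mapping.keys q. Poly_Mapping.keys m \<subseteq> V"
    and "m \<in> Poly_Mapping.keys (p * q)"
  then obtain a b where "m = a + b" "a \<in> Poly_Mapping.keys p" "b \<in> Poly_Mapping.keys q"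
    using keys_mult[of p q] by blast
  then show "Poly_Mapping.keys m \<subseteq> V"
    using p q Poly_Mapping.keys_add[of a b] by blast
qed

lemma polys_sum: "(\<And>x. x \<in> B \<Longrightarrow> f x \<in> polys V) \<Longrightarrow> sum f B \<in> polys V"
  by (induction B rule: infinite_finite_induct) (auto intro: polys_add)

lemmas polys_closed = polys_0 polys_1 polys_const polys_var polys_add polys_diff polys_uminus
  polys_mult polys_sum

lemma poly_eq_sum_single:
  "(\<Sum>m \<in> Poly_Mapping.keys p. Poly_Mapping.single m (Poly_Mapping.lookup p m)) = p"
  by (rule poly_mapping_eqI) (auto simp: lookup_sum lookup_single when_def in_keys_iff)

lemma polys_induct_single [consumes 1, case_names single add]:
  assumes "p \<in> polys V"
    and single: "\<And>m c. Poly_Mapping.keys m \<subseteq> V \<Longrightarrow> P (Poly_Mapping.single m c)"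
    and add: "\<And>p q. p \<in> polys V \<Longrightarrow> q \<in> polys V \<Longrightarrow> P p \<Longrightarrow> P q \<Longrightarrow> P (p + q)"
  shows "P p"
proof -
  \<comment> \<open>Membership in \<open>polys V\<close> is carried along because \<open>add\<close>
    asks for it for both summands.\<close>
  have "sum f B \<in> polys V \<and> P (sum f B)" if "finite B" "\<And>m. m \<in> B \<Longrightarrow> f m \<in> polys V \<and> P (f m)"
    for B and f :: "('a \<Rightarrow>\<^sub>0 nat) \<Rightarrow> _"
    using that
  proof (induction B rule: finite_induct)
    case empty
    then show ?case using single[of 0 0] by simp
  next
    case (insert x F)
    then show ?case by (auto intro: add polys_add)
  qed
  note sum_case = this
  have "Poly_Mapping.single m (Poly_Mapping.lookup p m) \<in> polys V \<and>
      P (Poly_Mapping.single m (Poly_Mapping.lookup p m))" if "m \<in> Poly_Mapping.keys p" for m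
  proof -
    have "Poly_Mapping.keys m \<subseteq> V" using assms(1) that by (simp add: polys_def)
    then show ?thesis by (blast intro: single polys_single)
  qed
  from sum_case[OF finite_keys[of p], of "\<lambda>m. Poly_Mapping.single m (Poly_Mapping.lookup p m)"] this
  show ?thesis
    by (simp add: poly_eq_sum_single)
qed

section \<open>Total degree of monomials and induction on polynomials\<close>

definition degm :: "('i \<Rightarrow>\<^sub>0 nat) \<Rightarrow> nat" where
  "degm m = (\<Sum>i \<in> Poly_Mapping.keys m. Poly_Mapping.lookup m i)"

lemma degm_superset:
  "finite V \<Longrightarrow> Poly_Mapping.keys m \<subseteq> V \<Longrightarrow> degm m = (\<Sum>i \<in> V. Poly_Mapping.lookup m i)"
  unfolding degm_def by (rule sum.mono_neutral_left) (auto simp: in_keys_iff)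

lemma monomial_split:
  fixes m :: "'i \<Rightarrow>\<^sub>0 nat"
  assumes "Poly_Mapping.lookup m i \<noteq> 0"
  shows "Poly_Mapping.single i 1 + (m - Poly_Mapping.single i 1) = m"
proof (rule poly_mapping_eqI)
  show "Poly_Mapping.lookup (Poly_Mapping.single i 1 + (m - Poly_Mapping.single i 1)) j =
      Poly_Mapping.lookup m j" for j
    using assms by (cases "j = i") (auto simp: lookup_add lookup_minus lookup_single)
qed

lemma keys_diff_monomial:
  "Poly_Mapping.keys (m - n) \<subseteq> Poly_Mapping.keys (m :: 'i \<Rightarrow>\<^sub>0 nat)"
  by (auto simp: in_keys_iff lookup_minus)

lemma degm_diff_single:
  fixes m :: "'i \<Rightarrow>\<^sub>0 nat"
  assumes "Poly_Mapping.lookup m i \<noteq> 0"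
  shows "degm m = Suc (degm (m - Poly_Mapping.single i 1))"
proof -
  have i: "i \<in> Poly_Mapping.keys m" using assms by (simp add: in_keys_iff)
  have "degm (m - Poly_Mapping.single i 1) =
      (\<Sum>j \<in> Poly_Mapping.keys m. Poly_Mapping.lookup m j - (if j = i then 1 else 0))"
    by (subst degm_superset[of "Poly_Mapping.keys m"])
       (auto simp: keys_diff_monomial lookup_minus lookup_single when_def intro!: sum.cong)
  also have "\<dots> = (Poly_Mapping.lookup m i - 1) + (\<Sum>j \<in> Poly_Mapping.keys m - {i}. Poly_Mapping.lookup m j)"
    using i by (subst sum.remove[of _ i]) (auto intro!: sum.cong)
  finally show ?thesis
    using assms i sum.remove[OF finite_keys i, of "Poly_Mapping.lookup m"] by (simp add: degm_def)
qed

text \<open>A monomial of positive degree is a variable times a monomial of smaller degree. This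
  form of induction matches commutators with variables: the step from \<open>p\<close> to
  \<open>var i * p\<close> is controlled by D (x_i p) = x_i D p + [D, x_i] p.\<close>

lemma polys_induct [consumes 1, case_names const add var]:
  assumes "p \<in> polys V"
    and const: "\<And>c. P (const_poly c)"
    and add: "\<And>p q. p \<in> polys V \<Longrightarrow> q \<in> polys V \<Longrightarrow> P p \<Longrightarrow> P q \<Longrightarrow> P (p + q)"
    and var: "\<And>i p. i \<in> V \<Longrightarrow> p \<in> polys V \<Longrightarrow> P p \<Longrightarrow> P (var i * p)"
  shows "P p"
  using assms(1)
proof (induction rule: polys_induct_single)
  case (single m c)
  then show ?case
  proof (induction "degm m" arbitrary: m)
    case 0
    then have "m = 0" by (auto simp: degm_def intro!: poly_mapping_eqI simp: in_keys_iff)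
    then show ?case using const[of c] by (simp add: const_poly_def)
  next
    case (Suc n)
    have "Poly_Mapping.keys m \<noteq> {}"
      using Suc(2) unfolding degm_def by (metis nat.distinct(1) sum.empty)
    then obtain i where i: "i \<in> Poly_Mapping.keys m" by blast
    let ?m = "m - Poly_Mapping.single i 1"
    have k: "Poly_Mapping.keys ?m \<subseteq> V" by (rule order.trans[OF keys_diff_monomial Suc(3)])
    have "n = degm ?m" using degm_diff_single[of m i] i Suc(2) by (simp add: in_keys_iff)
    from Suc(1)[OF this k] have "P (Poly_Mapping.single ?m c)" .
    then have "P (var i * Poly_Mapping.single ?m c)"
      using i Suc(3) k by (intro var polys_single) auto
    then show ?case
      using monomial_split[of m i] i by (simp add: var_def mult_single in_keys_iff)
  qed
qed (fact add)

text \<open>Although \<open>I\<close> may be infinite, each polynomial lives in finitely many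
  variables, over which Euler sums are finite.\<close>

lemma finite_vars: "p \<in> polys I \<Longrightarrow> \<exists>V. finite V \<and> V \<subseteq> I \<and> p \<in> polys V"
  by (rule exI[of _ "\<Union>m \<in> Poly_Mapping.keys p. Poly_Mapping.keys m"])
     (fastforce simp: polys_def)

section \<open>Leibniz rules for derivatives\<close>

lemma partial_deriv_add: "partial_deriv i (p + q) = partial_deriv i p + partial_deriv i q"
  by (rule poly_mapping_eqI) (simp add: lookup_partial_deriv lookup_add algebra_simps)

lemma partial_deriv_const_mult: "partial_deriv i (const_poly c * p) = const_poly c * partial_deriv i p"
  by (rule poly_mapping_eqI) (simp add: lookup_partial_deriv)

lemma partial_deriv_single:
  "partial_deriv i (Poly_Mapping.single m c) =
     Poly_Mapping.single (m - Poly_Mapping.single i 1) (of_nat (Poly_Mapping.lookup m i) * c)"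
  by (simp add: partial_deriv_def)

lemma partial_deriv_const [simp]: "partial_deriv i (const_poly c) = 0"
  by (simp add: const_poly_def partial_deriv_single)

lemma partial_deriv_1 [simp]: "partial_deriv i 1 = 0"
  using partial_deriv_const[of i 1] by simp

lemma partial_deriv_0 [simp]: "partial_deriv i 0 = 0"
  by (simp add: partial_deriv_def)

text \<open>A Leibniz rule with one variable as factor suffices, since \<open>polys_induct\<close>
  multiplies by one variable at a time.\<close>

lemma partial_deriv_var_mult:
  "partial_deriv i (var j * p) = var j * partial_deriv i p + (if i = j then p else 0)"
proof -
  have "p \<in> polys UNIV" by (simp add: polys_def)
  then show ?thesis
  proof (induction p rule: polys_induct_single)
    case (single m c)
    show ?case
    proof (cases "Poly_Mapping.lookup m i = 0")
      case True
      then show ?thesis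
        by (auto simp: var_def mult_single partial_deriv_single lookup_add lookup_single when_def)
    next
      case False
      \<comment> \<open>As \<open>i\<close> occurs in \<open>m\<close>, the truncated subtraction
        can be carried out inside \<open>m\<close>.\<close>
      have 1: "Poly_Mapping.single j 1 + m - Poly_Mapping.single i 1 =
          Poly_Mapping.single j 1 + (m - Poly_Mapping.single i 1)"
        by (rule poly_mapping_eqI) (use False in \<open>auto simp: lookup_add lookup_minus lookup_single when_def\<close>)
      show ?thesis
      proof (cases "i = j")
        case True
        then show ?thesis using 1 monomial_split[OF False]
          by (simp add: var_def mult_single partial_deriv_single lookup_add ring_distribs single_add)
      next
        case False
        then show ?thesis using 1
          by (simp add: var_def mult_single partial_deriv_single lookup_add lookup_single)
      qed
    qed
  next
    case (add p q)
    then show ?case by (simp add: ring_distribs partial_deriv_add)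
  qed
qed

lemma polys_partial_deriv: "p \<in> polys V \<Longrightarrow> partial_deriv i p \<in> polys V"
  by (induction p rule: polys_induct) (auto simp: partial_deriv_add partial_deriv_var_mult intro!: polys_closed)

lemma partial_deriv_outside: "p \<in> polys V \<Longrightarrow> i \<notin> V \<Longrightarrow> partial_deriv i p = 0"
  by (induction p rule: polys_induct) (auto simp: partial_deriv_add partial_deriv_var_mult)

lemma const_poly_of_nat: "const_poly (of_nat n) = of_nat n"
  by (simp add: const_poly_def single_of_nat)

lemma partial_deriv_of_nat: "partial_deriv i (of_nat n * p) = of_nat n * partial_deriv i p"
  using partial_deriv_const_mult[of i "of_nat n" p] by (simp add: const_poly_of_nat)

lemma multi_deriv_add: "multi_deriv J (p + q) = multi_deriv J p + multi_deriv J q"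
  by (induction J) (simp_all add: partial_deriv_add)

lemma multi_deriv_const: "multi_deriv J (const_poly c) = (if J = {#} then const_poly c else 0)"
proof (induction J)
  case (add i J)
  then show ?case by simp
qed simp

lemma polys_multi_deriv: "p \<in> polys V \<Longrightarrow> multi_deriv J p \<in> polys V"
  by (induction J) (auto intro: polys_partial_deriv)

lemma multi_deriv_outside:
  assumes "p \<in> polys V" "\<not> set_mset J \<subseteq> V"
  shows "multi_deriv J p = 0"
proof -
  obtain i K where "J = add_mset i K" "i \<notin> V"
    using assms(2) by (metis multi_member_split subsetI)
  then show ?thesis
    using partial_deriv_outside[OF polys_multi_deriv[OF assms(1)]] by simp
qed

text \<open>The commutator of \<partial>^J with x_i is J_i \<partial>^(J - i). If \<open>i\<close>
  does not occur in \<open>J\<close>, the coefficient vanishes and the truncated difference does no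
  harm.\<close>

lemma multi_deriv_var_mult:
  "multi_deriv J (var i * p) = var i * multi_deriv J p + of_nat (count J i) * multi_deriv (J - {#i#}) p"
proof (induction J)
  case (add j J)
  have 1: "of_nat (count J i) * partial_deriv j (multi_deriv (J - {#i#}) p) =
      of_nat (count J i) * multi_deriv (add_mset j J - {#i#}) p"
  proof (cases "i \<in># J")
    case True
    then have "add_mset j J - {#i#} = add_mset j (J - {#i#})"
      by (simp add: multiset_eq_iff)
    then show ?thesis by (simp only: multi_deriv_add_mset)
  qed (simp add: not_in_iff)
  have "multi_deriv (add_mset j J) (var i * p) =
      partial_deriv j (var i * multi_deriv J p) +
      of_nat (count J i) * partial_deriv j (multi_deriv (J - {#i#}) p)"
    by (simp only: multi_deriv_add_mset add.IH partial_deriv_add partial_deriv_of_nat)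
  also have "\<dots> = var i * partial_deriv j (multi_deriv J p) + (if j = i then multi_deriv J p else 0) +
      of_nat (count J i) * multi_deriv (add_mset j J - {#i#}) p"
    by (simp only: 1 partial_deriv_var_mult)
  also have "\<dots> = var i * multi_deriv (add_mset j J) p +
      of_nat (count (add_mset j J) i) * multi_deriv (add_mset j J - {#i#}) p"
    by (cases "i = j") (simp_all add: algebra_simps)
  finally show ?case .
qed simp

section \<open>Differential operators\<close>

text \<open>The values need not lie in \<open>polys V\<close>: operators on the full algebra get
  restricted to finitely many variables, and their values may involve further ones.\<close>

definition linear_on :: "'i set \<Rightarrow> (('i, 'f::field) mpoly \<Rightarrow> ('i, 'f) mpoly) \<Rightarrow> bool" where
  "linear_on V D \<longleftrightarrow>
     (\<forall>p \<in> polys V. \<forall>q \<in> polys V. D (p + q) = D p + D q) \<and>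
     (\<forall>c. \<forall>p \<in> polys V. D (const_poly c * p) = const_poly c * D p)"

lemma linear_on_add: "linear_on V D \<Longrightarrow> p \<in> polys V \<Longrightarrow> q \<in> polys V \<Longrightarrow> D (p + q) = D p + D q"
  by (simp add: linear_on_def)

lemma linear_on_const_mult:
  "linear_on V D \<Longrightarrow> p \<in> polys V \<Longrightarrow> D (const_poly c * p) = const_poly c * D p"
  by (simp add: linear_on_def)

lemma linear_on_0: "linear_on V D \<Longrightarrow> D 0 = 0"
  using linear_on_const_mult[of V D 0 0] by simp

lemma linear_on_const: "linear_on V D \<Longrightarrow> D (const_poly c) = const_poly c * D 1"
  using linear_on_const_mult[of V D 1 c] by simp

lemma linear_on_diff:
  assumes "linear_on V D" "p \<in> polys V" "q \<in> polys V"
  shows "D (p - q) = D p - D q"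
  using linear_on_add[OF assms(1) polys_diff[OF assms(2,3)] assms(3)] by simp

lemma linear_on_mono: "linear_on W D \<Longrightarrow> V \<subseteq> W \<Longrightarrow> linear_on V D"
  unfolding linear_on_def using polys_mono[of V W] by (meson subsetD)

lemma linear_on_diff_fun: "linear_on V D \<Longrightarrow> linear_on V D' \<Longrightarrow> linear_on V (\<lambda>p. D p - D' p)"
  unfolding linear_on_def by (simp add: right_diff_distrib)

lemma linear_on_mult_fun: "linear_on V D \<Longrightarrow> linear_on V (\<lambda>p. a * D p)"
  unfolding linear_on_def by (simp add: distrib_left mult.left_commute)

text \<open>The commutator of \<open>D\<close> with multiplication by x_i.\<close>

definition ad :: "'i \<Rightarrow> (('i, 'f::field) mpoly \<Rightarrow> ('i, 'f) mpoly) \<Rightarrow> ('i, 'f) mpoly \<Rightarrow> ('i, 'f) mpoly" where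
  "ad i D = (\<lambda>p. D (var i * p) - var i * D p)"

text \<open>Multiplications by variables commute with each other, so this is the Jacobi identity. It
  allows iterated commutators to be indexed by multisets.\<close>

lemma ad_commute: "ad i (ad j D) = ad j (ad i D)"
  by (rule ext) (simp add: ad_def mult.left_commute[of "var i" "var j"] algebra_simps)

lemma linear_on_ad:
  assumes "linear_on V D" "i \<in> V"
  shows "linear_on V (ad i D)"
  unfolding linear_on_def
proof (intro conjI ballI allI)
  fix p q :: "('a, 'b) mpoly" and c
  assume p: "p \<in> polys V"
  have ip: "var i * p \<in> polys V" using p assms(2) by (intro polys_mult polys_var)
  show "ad i D (const_poly c * p) = const_poly c * ad i D p"
    using linear_on_const_mult[OF assms(1) p, of c] linear_on_const_mult[OF assms(1) ip, of c]
    by (simp add: ad_def mult.left_commute[of "var i"] right_diff_distrib)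
  assume q: "q \<in> polys V"
  have iq: "var i * q \<in> polys V" using q assms(2) by (intro polys_mult polys_var)
  show "ad i D (p + q) = ad i D p + ad i D q"
    using linear_on_add[OF assms(1) p q] linear_on_add[OF assms(1) ip iq]
    by (simp add: ad_def distrib_left)
qed

text \<open>\<open>dop V n\<close> describes the differential operators of order less than \<open>n\<close>, by Grothendieck's
  criterion.\<close>

primrec dop :: "'i set \<Rightarrow> nat \<Rightarrow> (('i, 'f::field) mpoly \<Rightarrow> ('i, 'f) mpoly) \<Rightarrow> bool" where
  "dop V 0 D \<longleftrightarrow> (\<forall>p \<in> polys V. D p = 0)"
| "dop V (Suc n) D \<longleftrightarrow> (\<forall>i \<in> V. dop V n (ad i D))"

lemma dop_cong: "dop V n D \<Longrightarrow> (\<And>p. p \<in> polys V \<Longrightarrow> D' p = D p) \<Longrightarrow> dop V n D'"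
proof (induction n arbitrary: D D')
  case (Suc n)
  have "dop V n (ad i D')" if "i \<in> V" for i
    using Suc.prems that by (rule_tac Suc.IH[of "ad i D"]) (auto simp: ad_def polys_mult polys_var)
  then show ?case by simp
qed simp

lemma dop_mono_vars: "dop W n D \<Longrightarrow> V \<subseteq> W \<Longrightarrow> dop V n D"
proof (induction n arbitrary: D)
  case 0
  then show ?case using polys_mono[of V W] by auto
qed auto

lemma dop_Suc: "dop V n D \<Longrightarrow> dop V (Suc n) D"
  by (induction n arbitrary: D) (auto simp: ad_def polys_mult polys_var)

lemma dop_mono:
  assumes "dop V n D" "n \<le> n'"
  shows "dop V n' D"
  using assms(2) by (induction rule: dec_induct) (fact assms(1), rule dop_Suc)

lemma dop_0: "dop V n (\<lambda>p. 0)"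
  by (induction n) (simp_all add: ad_def)

lemma dop_add: "dop V n D \<Longrightarrow> dop V n D' \<Longrightarrow> dop V n (\<lambda>p. D p + D' p)"
proof (induction n arbitrary: D D')
  case (Suc n)
  have "ad i (\<lambda>p. D p + D' p) = (\<lambda>p. ad i D p + ad i D' p)" for i
    by (simp add: ad_def fun_eq_iff algebra_simps)
  then show ?case using Suc by simp
qed simp

lemma dop_mult: "dop V n D \<Longrightarrow> dop V n (\<lambda>p. a * D p)"
proof (induction n arbitrary: D)
  case (Suc n)
  have "ad i (\<lambda>p. a * D p) = (\<lambda>p. a * ad i D p)" for i
    by (simp add: ad_def fun_eq_iff algebra_simps)
  then show ?case using Suc by simp
qed simp

lemma dop_uminus: "dop V n D \<Longrightarrow> dop V n (\<lambda>p. - D p)"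
  using dop_mult[of V n D "-1"] by simp

lemma dop_diff: "dop V n D \<Longrightarrow> dop V n D' \<Longrightarrow> dop V n (\<lambda>p. D p - D' p)"
  using dop_add[of V n D "\<lambda>p. - D' p"] dop_uminus[of V n D'] by simp

lemma dop_sum: "(\<And>x. x \<in> B \<Longrightarrow> dop V n (D x)) \<Longrightarrow> dop V n (\<lambda>p. \<Sum>x\<in>B. D x p)"
  by (induction B rule: infinite_finite_induct) (auto intro: dop_0 dop_add)

lemma dop_premult: "dop V n D \<Longrightarrow> a \<in> polys V \<Longrightarrow> dop V n (\<lambda>p. D (a * p))"
proof (induction n arbitrary: D)
  case (Suc n)
  have "ad i (\<lambda>p. D (a * p)) = (\<lambda>p. ad i D (a * p))" for i
    by (simp add: ad_def fun_eq_iff mult.left_commute)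
  then show ?case using Suc by simp
qed (simp add: polys_mult)

lemma dop_multiplication: "n \<ge> 1 \<Longrightarrow> dop V n (\<lambda>p. a * p)"
  by (rule dop_mono[of _ 1]) (simp_all add: ad_def mult.left_commute)

lemma dop_partial_deriv: "dop V 2 (partial_deriv i)"
  by (auto simp: numeral_2_eq_2 ad_def partial_deriv_var_mult)

text \<open>Taking commutators is a derivation: [D D', x_i] = [D, x_i] D' + D [D', x_i]. The
  induction lowers one of the two bounds at a time, and ends when one factor is zero on
  \<open>polys V\<close>; then the composition is zero too.\<close>

lemma dop_comp:
  assumes "linear_on V D" "dop V m D" "dop V n D'" "\<And>p. p \<in> polys V \<Longrightarrow> D' p \<in> polys V"
  shows "dop V (m + n) (\<lambda>p. D (D' p))"
  using assms
proof (induction "m + n" arbitrary: m n D D')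
  case 0
  then show ?case by (auto simp: linear_on_0)
next
  case (Suc k)
  consider "m = 0" | "n = 0" | m' n' where "m = Suc m'" "n = Suc n'"
    by (metis not0_implies_Suc)
  then show ?case
  proof cases
    case 1
    then have "dop V 0 (\<lambda>p. D (D' p))" using Suc.prems by auto
    then show ?thesis by (rule dop_mono) simp
  next
    case 2
    then have "dop V 0 (\<lambda>p. D (D' p))" using Suc.prems by (auto simp: linear_on_0)
    then show ?thesis by (rule dop_mono) simp
  next
    case 3
    have "dop V k (ad i (\<lambda>p. D (D' p)))" if i: "i \<in> V" for i
    proof -
      have D': "ad i D' p \<in> polys V" if "p \<in> polys V" for p
        using that i Suc.prems(4) by (simp add: ad_def polys_diff polys_mult polys_var)
      have "dop V (m' + n) (\<lambda>p. ad i D (D' p))"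
        using Suc.hyps(2) Suc.prems 3 i by (rule_tac Suc.hyps(1)) (auto intro: linear_on_ad)
      moreover have "dop V (m + n') (\<lambda>p. D (ad i D' p))"
        using Suc.hyps(2) Suc.prems 3 i by (rule_tac Suc.hyps(1)) (auto intro: D')
      ultimately have "dop V k (\<lambda>p. ad i D (D' p) + D (ad i D' p))"
        using Suc.hyps(2) 3 by (intro dop_add) (auto simp del: dop.simps)
      then show ?thesis
      proof (rule dop_cong)
        fix p :: "('a, 'b) mpoly"
        assume p: "p \<in> polys V"
        then have "D (ad i D' p) = D (D' (var i * p)) - D (var i * D' p)"
          using Suc.prems(4) i unfolding ad_def
          by (intro linear_on_diff[OF Suc.prems(1)]) (auto intro: polys_mult polys_var)
        then show "ad i (\<lambda>p. D (D' p)) p = ad i D (D' p) + D (ad i D' p)"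
          by (simp add: ad_def)
      qed
    qed
    then show ?thesis unfolding Suc.hyps(2)[symmetric] by simp
  qed
qed

text \<open>The criterion looks at \<open>n\<close> commutators and one argument at a time, hence at
  finitely many variables. The set \<open>S\<close> collects the variables of the commutators taken
  so far.\<close>

lemma dop_if_finite_vars:
  assumes "finite S" "S \<subseteq> I" "\<And>V. finite V \<Longrightarrow> S \<subseteq> V \<Longrightarrow> V \<subseteq> I \<Longrightarrow> dop V n D"
  shows "dop I n D"
  using assms
proof (induction n arbitrary: D S)
  case 0
  show ?case unfolding dop.simps
  proof
    fix p :: "('a, 'b) mpoly"
    assume "p \<in> polys I"
    then obtain V where V: "finite V" "V \<subseteq> I" "p \<in> polys V" using finite_vars by blast
    then have "p \<in> polys (V \<union> S)" using polys_mono[of V "V \<union> S"] by blast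
    then show "D p = 0" using 0(3)[of "V \<union> S"] 0(1,2) V by simp
  qed
next
  case (Suc n)
  have "dop I n (ad i D)" if "i \<in> I" for i
    using that Suc.prems by (rule_tac Suc.IH[of "insert i S"]) auto
  then show ?case by simp
qed

section \<open>The Euler operator on symbols\<close>

definition ad_euler :: "'i set \<Rightarrow> (('i, 'f::field) mpoly \<Rightarrow> ('i, 'f) mpoly) \<Rightarrow> ('i, 'f) mpoly \<Rightarrow> ('i, 'f) mpoly" where
  "ad_euler V D p = (\<Sum>i\<in>V. ad i D (partial_deriv i p))"

text \<open>Since [\<partial>_i, x_k] is 1 for i = k and 0 otherwise, commuting with x_k passes
  through the sum, up to one extra copy of [D, x_k].\<close>

lemma ad_ad_euler:
  assumes "finite V" "linear_on V D" "k \<in> V" "p \<in> polys V"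
  shows "ad k (ad_euler V D) p = ad_euler V (ad k D) p + ad k D p"
proof -
  have "ad_euler V D (var k * p) = (\<Sum>i\<in>V. ad i D (var k * partial_deriv i p) + (if i = k then ad i D p else 0))"
    unfolding ad_euler_def
  proof (rule sum.cong)
    fix i assume "i \<in> V"
    with assms show "ad i D (partial_deriv i (var k * p)) =
        ad i D (var k * partial_deriv i p) + (if i = k then ad i D p else 0)"
      using linear_on_add[OF linear_on_ad[OF assms(2) \<open>i \<in> V\<close>], of "var k * partial_deriv i p" p]
      by (auto simp: partial_deriv_var_mult polys_mult polys_var polys_partial_deriv)
  qed simp
  also have "\<dots> = (\<Sum>i\<in>V. ad i D (var k * partial_deriv i p)) + ad k D p"
    using assms by (simp add: sum.distrib sum.delta)
  finally have 1: "ad_euler V D (var k * p) = (\<Sum>i\<in>V. ad i D (var k * partial_deriv i p)) + ad k D p" .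
  have "ad_euler V (ad k D) p = (\<Sum>i\<in>V. ad k (ad i D) (partial_deriv i p))"
    unfolding ad_euler_def by (simp only: ad_commute[of k])
  also have "\<dots> = (\<Sum>i\<in>V. ad i D (var k * partial_deriv i p)) - var k * ad_euler V D p"
    unfolding ad_euler_def ad_def[of k] by (simp add: sum_subtractf sum_distrib_left)
  finally show ?thesis
    unfolding ad_def[of k "ad_euler V D"] 1 by simp
qed

lemma const_poly_mult_cancel: "c \<noteq> 0 \<Longrightarrow> const_poly c * p = 0 \<longleftrightarrow> p = 0"
  by (simp add: poly_mapping_eq_iff fun_eq_iff)

text \<open>By \<open>ad_ad_euler\<close>, the hypothesis for \<open>D\<close> and \<open>c\<close>
  yields the same hypothesis for [D, x_k] and c + 1. The induction on \<open>p\<close> therefore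
  generalises both, and the multiple of \<open>D\<close> never becomes zero in characteristic
  0.\<close>

lemma dop_0_if_ad_euler:
  fixes D :: "('i, 'f::field_char_0) mpoly \<Rightarrow> ('i, 'f) mpoly"
  assumes "p \<in> polys V" "finite V" "linear_on V D"
    and "\<And>p. p \<in> polys V \<Longrightarrow> const_poly (of_nat (Suc c)) * D p + ad_euler V D p = 0"
  shows "D p = 0"
  using assms
proof (induction p arbitrary: D c rule: polys_induct)
  case (const a)
  \<comment> \<open>All derivatives of 1 vanish, so at 1 only the non-zero multiple of
    \<open>D\<close> is left.\<close>
  have "ad_euler V D 1 = 0"
    by (simp add: ad_euler_def ad_def linear_on_0[OF const(2)])
  then have "D 1 = 0"
    using const(3)[OF polys_1] const_poly_mult_cancel[of "of_nat (Suc c)" "D 1"]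
      of_nat_neq_0[of c, where 'a='f] by simp
  then show ?case using linear_on_const[OF const(2)] by simp
next
  case (add p q)
  have "D p = 0" "D q = 0"
    using add.IH(1)[OF add.prems] add.IH(2)[OF add.prems] by simp_all
  then show ?case using add by (simp add: linear_on_add)
next
  case (var k p)
  have "ad k D p = 0"
  proof (rule var.IH)
    show "finite V" by fact
    show "linear_on V (ad k D)" using var by (simp add: linear_on_ad)
    fix q :: "('i, 'f) mpoly"
    assume q: "q \<in> polys V"
    \<comment> \<open>The hypothesis at x_k q minus x_k times the hypothesis at q.\<close>
    then have "0 = (const_poly (of_nat (Suc c)) * D (var k * q) + ad_euler V D (var k * q)) -
        var k * (const_poly (of_nat (Suc c)) * D q + ad_euler V D q)"
      using var.prems(3) var.hyps by (simp add: polys_mult polys_var)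
    also have "\<dots> = const_poly (of_nat (Suc c)) * ad k D q + ad k (ad_euler V D) q"
      by (simp add: ad_def algebra_simps)
    also have "\<dots> = const_poly (of_nat (Suc (Suc c))) * ad k D q + ad_euler V (ad k D) q"
    proof -
      have "(const_poly (of_nat (Suc (Suc c))) :: ('i, 'f) mpoly) = const_poly (of_nat (Suc c)) + 1"
        by (simp only: of_nat_Suc[of "Suc c"] const_poly_simps add.commute)
      then show ?thesis
        using ad_ad_euler[OF var.prems(1,2) var.hyps(1) q] by (simp only: ring_distribs mult_1 ac_simps)
    qed
    finally show "const_poly (of_nat (Suc (Suc c))) * ad k D q + ad_euler V (ad k D) q = 0" ..
  qed
  moreover have "D p = 0" using var.IH[OF var.prems] .
  ultimately show ?case by (simp add: ad_def)
qed

text \<open>On the symbol of \<open>D\<close>, the map \<open>D \<mapsto> ad_euler V D\<close> is the Euler operator of the dual variables,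
  so adding a positive multiple of \<open>D\<close> to it cannot lower the order.\<close>

lemma dop_if_dop_ad_euler:
  fixes D :: "('i, 'f::field_char_0) mpoly \<Rightarrow> ('i, 'f) mpoly"
  assumes "finite V" "linear_on V D"
    and "dop V n (\<lambda>p. const_poly (of_nat (Suc c)) * D p + ad_euler V D p)"
  shows "dop V n D"
  using assms
proof (induction n arbitrary: D c)
  case 0
  then show ?case using dop_0_if_ad_euler[of _ V D c] by simp
next
  case (Suc n)
  have "dop V n (ad k D)" if k: "k \<in> V" for k
  proof (rule Suc.IH)
    show "finite V" by fact
    show "linear_on V (ad k D)" using Suc k by (simp add: linear_on_ad)
    have "dop V n (ad k (\<lambda>p. const_poly (of_nat (Suc c)) * D p + ad_euler V D p))"
      using Suc.prems(3) k by simp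
    \<comment> \<open>The extra copy of [D, x_k] from \<open>ad_ad_euler\<close> raises
      \<open>c\<close> by one.\<close>
    then show "dop V n (\<lambda>p. const_poly (of_nat (Suc (Suc c))) * ad k D p + ad_euler V (ad k D) p)"
    proof (rule dop_cong)
      fix p :: "('i, 'f) mpoly"
      assume "p \<in> polys V"
      then have 1: "ad k (ad_euler V D) p = ad_euler V (ad k D) p + ad k D p"
        using Suc.prems k by (intro ad_ad_euler)
      have 2: "ad k (\<lambda>p. a * D p + ad_euler V D p) p = a * ad k D p + ad k (ad_euler V D) p" for a
        by (simp add: ad_def algebra_simps)
      have 3: "(const_poly (of_nat (Suc (Suc c))) :: ('i, 'f) mpoly) = const_poly (of_nat (Suc c)) + 1"
        by (simp only: of_nat_Suc[of "Suc c"] const_poly_simps add.commute)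
      show "const_poly (of_nat (Suc (Suc c))) * ad k D p + ad_euler V (ad k D) p =
          ad k (\<lambda>p. const_poly (of_nat (Suc c)) * D p + ad_euler V D p) p"
        unfolding 2 unfolding 1 3 by (simp only: ring_distribs mult_1 ac_simps)
    qed
  qed
  then show ?case by simp
qed

section \<open>Taylor expansion of linear operators\<close>

interpretation ad: comp_fun_commute ad
  by standard (simp add: fun_eq_iff ad_commute)

definition multi_ad :: "'i multiset \<Rightarrow> (('i, 'f::field) mpoly \<Rightarrow> ('i, 'f) mpoly) \<Rightarrow> ('i, 'f) mpoly \<Rightarrow> ('i, 'f) mpoly" where
  "multi_ad J D = fold_mset ad D J"

lemma multi_ad_empty [simp]: "multi_ad {#} D = D"
  by (simp add: multi_ad_def)

lemma multi_ad_add_mset: "multi_ad (add_mset i J) D = ad i (multi_ad J D)"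
  by (simp add: multi_ad_def)

text \<open>Iterated commutators grow at the outside, whereas \<open>dop\<close> takes them off at
  the inside; this lemma mediates.\<close>

lemma multi_ad_ad: "multi_ad J (ad i D) = ad i (multi_ad J D)"
  by (simp add: multi_ad_def ad.fold_mset_fun_left_comm)

lemma multi_ad_polys:
  assumes "set_mset J \<subseteq> I" "\<And>p. p \<in> polys I \<Longrightarrow> D p \<in> polys I" "p \<in> polys I"
  shows "multi_ad J D p \<in> polys I"
  using assms(1,3)
proof (induction J arbitrary: p)
  case (add i J)
  then show ?case
    by (simp add: multi_ad_add_mset ad_def polys_diff polys_mult polys_var)
qed (simp add: assms(2))

text \<open>The first \<open>n\<close> commutators give an operator that is zero on
  \<open>polys I\<close>, and all further ones keep it zero there.\<close>

lemma dop_multi_ad_eq_0: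
  assumes "dop I n D" "n \<le> size J" "set_mset J \<subseteq> I" "p \<in> polys I"
  shows "multi_ad J D p = 0"
  using assms
proof (induction n arbitrary: D J)
  case 0
  have "multi_ad J D p = 0" if "p \<in> polys I" for p
    using 0(3) that
  proof (induction J arbitrary: p)
    case (add i J)
    then show ?case by (simp add: multi_ad_add_mset ad_def polys_mult polys_var)
  qed (use 0(1) in simp)
  then show ?case using 0(4) .
next
  case (Suc n)
  then obtain i K where J: "J = add_mset i K"
    by (metis Suc_le_D size_eq_Suc_imp_eq_union)
  with Suc.prems have "multi_ad K (ad i D) p = 0"
    by (intro Suc.IH) auto
  then show ?case by (simp add: J multi_ad_add_mset multi_ad_ad)
qed

text \<open>The factor 1/J! of Taylor's formula, where J! is the product of the factorials of the
  multiplicities.\<close>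

definition inv_fact_mset :: "'i multiset \<Rightarrow> 'f::field_char_0" where
  "inv_fact_mset J = (\<Prod>i\<in>set_mset J. 1 / fact (count J i))"

lemma inv_fact_mset_add_mset:
  "of_nat (Suc (count J i)) * inv_fact_mset (add_mset i J) = (inv_fact_mset J :: 'f::field_char_0)"
proof -
  have 1: "(\<Prod>j\<in>set_mset J - {i}. 1 / fact (count (add_mset i J) j) :: 'f) =
      (\<Prod>j\<in>set_mset J - {i}. 1 / fact (count J j))"
    by (rule prod.cong) auto
  have 2: "(\<Prod>j\<in>set_mset J. 1 / fact (count J j) :: 'f) =
      1 / fact (count J i) * (\<Prod>j\<in>set_mset J - {i}. 1 / fact (count J j))"
    by (cases "i \<in># J") (simp_all add: prod.remove not_in_iff)
  show ?thesis
    unfolding inv_fact_mset_def 2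
    by (simp add: prod.insert_remove 1 del: of_nat_Suc count_add_mset)
       (simp add: of_nat_neq_0 del: of_nat_Suc)
qed

lemma finite_taylor_support:
  "finite {J. const_poly (inv_fact_mset J) * f J * multi_deriv J p \<noteq> 0}"
  by (rule finite_subset[OF _ finite_multi_deriv_nonzero[of p]]) auto

text \<open>The candidate for the normal form of \<open>D\<close>: the coefficient of \<partial>^J
  is the iterated commutator of \<open>D\<close> applied to 1, divided by J!. Infinitely many
  coefficients may be non-zero, but for each \<open>p\<close> the sum is finite.\<close>

definition taylor where
  "taylor D p = Sum_any (\<lambda>J. const_poly (inv_fact_mset J) * multi_ad J D 1 * multi_deriv J p)"

lemma taylor_add: "taylor D (p + q) = taylor D p + taylor D q"
  unfolding taylor_def multi_deriv_add distrib_left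
  by (rule Sum_any.distrib) (rule finite_taylor_support)+

text \<open>The Leibniz rule for \<partial>^J yields a second sum, with terms J_i \<partial>^(J -
  i). Substituting J = K + i and cancelling J_i against J! turns it into the expansion of
  [D, x_i].\<close>

lemma taylor_var_mult: "taylor D (var i * p) = var i * taylor D p + taylor (ad i D) p"
proof -
  define c where "c J = const_poly (inv_fact_mset J) * multi_ad J D 1" for J
  have c: "c (add_mset i J) * of_nat (Suc (count J i)) =
      const_poly (inv_fact_mset J) * multi_ad J (ad i D) 1" for J
    unfolding c_def inv_fact_mset_add_mset[of J i, symmetric] const_poly_simps(4) const_poly_of_nat
    by (simp only: multi_ad_add_mset multi_ad_ad ac_simps)
  let ?g = "\<lambda>J. c J * (of_nat (count J i) * multi_deriv (J - {#i#}) p)"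
  have g: "?g (add_mset i J) = const_poly (inv_fact_mset J) * multi_ad J (ad i D) 1 * multi_deriv J p" for J
    unfolding c[symmetric] by (simp only: add_mset_remove_trivial count_add_mset if_True mult.assoc refl)
  \<comment> \<open>Multi-indices without \<open>i\<close> contribute nothing because of the factor
    \<open>count J i\<close>.\<close>
  have supp: "{J. ?g J \<noteq> 0} = add_mset i ` {J. ?g (add_mset i J) \<noteq> 0}"
  proof (intro equalityI subsetI)
    fix J assume J: "J \<in> {J. ?g J \<noteq> 0}"
    then have "count J i \<noteq> 0" by (intro notI) simp
    then have "i \<in># J" by simp
    then obtain K where "J = add_mset i K" by (metis multi_member_split)
    then show "J \<in> add_mset i ` {J. ?g (add_mset i J) \<noteq> 0}" using J by blast
  qed auto
  have fin: "finite {J. ?g J \<noteq> 0}"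
    unfolding supp g by (intro finite_imageI finite_taylor_support)
  have "Sum_any ?g = sum ?g (add_mset i ` {J. ?g (add_mset i J) \<noteq> 0})"
    unfolding Sum_any.expand_set[of ?g] supp ..
  also have "\<dots> = (\<Sum>J \<in> {J. ?g (add_mset i J) \<noteq> 0}. ?g (add_mset i J))"
    by (subst sum.reindex) (auto simp: inj_on_def)
  also have "\<dots> = taylor (ad i D) p"
    unfolding g taylor_def Sum_any.expand_set ..
  finally have 1: "Sum_any ?g = taylor (ad i D) p" .
  have "taylor D (var i * p) = Sum_any (\<lambda>J. var i * (c J * multi_deriv J p) + ?g J)"
    unfolding taylor_def c_def[symmetric] multi_deriv_var_mult
    by (simp only: distrib_left mult.left_commute)
  also have "\<dots> = Sum_any (\<lambda>J. var i * (c J * multi_deriv J p)) + Sum_any ?g"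
    by (rule Sum_any.distrib[OF finite_subset[OF _ finite_multi_deriv_nonzero[of p]] fin]) auto
  also have "Sum_any (\<lambda>J. var i * (c J * multi_deriv J p)) = var i * taylor D p"
    unfolding taylor_def c_def by (rule Sum_any_right_distrib[symmetric]) (rule finite_taylor_support)
  finally show ?thesis unfolding 1 .
qed

lemma taylor_const:
  fixes D :: "('i, 'f::field_char_0) mpoly \<Rightarrow> ('i, 'f) mpoly"
  shows "taylor D (const_poly c) = const_poly c * D 1"
proof -
  have "taylor D (const_poly c) = Sum_any (\<lambda>J :: 'i multiset. if J = {#} then const_poly c * D 1 else 0)"
    unfolding taylor_def
    by (rule arg_cong[of _ _ Sum_any], rule ext) (simp add: multi_deriv_const inv_fact_mset_def mult.commute)
  then show ?thesis by simp
qed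

text \<open>Both sides agree on constants and obey the same recursion D (x_i p) = x_i D p + [D, x_i]
  p. The expansion holds for every linear \<open>D\<close>; a bound on the order matters only for
  the vanishing of coefficients.\<close>

lemma taylor_expansion:
  assumes "p \<in> polys I" "linear_on I D"
  shows "taylor D p = D p"
  using assms
proof (induction p arbitrary: D rule: polys_induct)
  case (const c)
  then show ?case by (simp add: taylor_const linear_on_const[of I D])
next
  case (add p q)
  then show ?case by (simp add: taylor_add linear_on_add[of I D])
next
  case (var i p)
  then have "taylor (ad i D) p = ad i D p"
    by (intro var.IH linear_on_ad)
  with var show ?case by (simp add: taylor_var_mult ad_def)
qed

text \<open>Derivatives in variables outside \<open>I\<close> vanish on \<open>polys I\<close>, so
  the coefficients can be cut off as \<open>differential_operator2\<close> demands.\<close>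

lemma taylor_expansion_polys:
  assumes "linear_on I \<phi>" "p \<in> polys I"
  shows "\<phi> p = Sum_any (\<lambda>J. if set_mset J \<subseteq> I
     then const_poly (inv_fact_mset J) * multi_ad J \<phi> 1 * multi_deriv J p else 0)"
  unfolding taylor_expansion[OF assms(2,1), symmetric] taylor_def
  by (rule arg_cong[of _ _ Sum_any], rule ext) (auto simp: multi_deriv_outside[OF assms(2)])

section \<open>Cochains of normalised products\<close>

text \<open>The bound \<open>n\<close> is uniform in the argument that is held fixed; otherwise it
  would not bound the joint order.\<close>

definition bidop :: "'i set \<Rightarrow> nat \<Rightarrow> (('i, 'f::field) mpoly \<Rightarrow> ('i, 'f) mpoly \<Rightarrow> ('i, 'f) mpoly) \<Rightarrow> bool" where
  "bidop I n \<phi> \<longleftrightarrow> (\<forall>p \<in> polys I. dop I n (\<phi> p) \<and> dop I n (\<lambda>q. \<phi> q p))"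

lemma bidop_mono: "bidop I n \<phi> \<Longrightarrow> n \<le> n' \<Longrightarrow> bidop I n' \<phi>"
  unfolding bidop_def by (meson dop_mono)

definition bilinear_on :: "'i set \<Rightarrow> (('i, 'f::field) mpoly \<Rightarrow> ('i, 'f) mpoly \<Rightarrow> ('i, 'f) mpoly) \<Rightarrow> bool" where
  "bilinear_on I \<phi> \<longleftrightarrow>
     (\<forall>p \<in> polys I. linear_on I (\<phi> p) \<and> linear_on I (\<lambda>q. \<phi> q p) \<and> (\<forall>q \<in> polys I. \<phi> p q \<in> polys I))"

text \<open>Commutators in the first argument only form combinations of maps \<phi>(p', -) with
  polynomial coefficients, so they do not raise the order in the second argument.\<close>

lemma multi_ad_first:
  assumes "bilinear_on I \<phi>" "bidop I n \<phi>" "set_mset J \<subseteq> I" "p \<in> polys I"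
  shows "linear_on I (\<lambda>q. multi_ad J (\<lambda>p. \<phi> p q) p) \<and> dop I n (\<lambda>q. multi_ad J (\<lambda>p. \<phi> p q) p)"
  using assms(3,4)
proof (induction J arbitrary: p)
  case empty
  then show ?case using assms(1,2) by (simp add: bilinear_on_def bidop_def)
next
  case (add i J)
  then have "var i * p \<in> polys I" by (intro polys_mult polys_var) auto
  then show ?case
    using add by (simp add: multi_ad_add_mset ad_def linear_on_diff_fun linear_on_mult_fun dop_diff dop_mult)
qed

text \<open>Taylor expansion in the first argument has operators \<open>\<Phi> J\<close> in the
  second argument as coefficients, and these are expanded in turn. Non-zero coefficients have both
  \<open>size J\<close> and \<open>size K\<close> below \<open>n\<close>.\<close>

lemma differential_operator2_if_bidop:
  fixes \<phi> :: "('i, 'f::field_char_0) mpoly \<Rightarrow> ('i, 'f) mpoly \<Rightarrow> ('i, 'f) mpoly"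
  assumes bilinear: "bilinear_on I \<phi>" and bidop: "bidop I n \<phi>"
  shows "differential_operator2 I \<phi>"
proof -
  define \<Phi> where "\<Phi> J q = multi_ad J (\<lambda>p. \<phi> p q) 1" for J q
  define w where "w J = (const_poly (inv_fact_mset J) :: ('i, 'f) mpoly)" for J :: "'i multiset"
  define c where "c J K = (if set_mset J \<subseteq> I \<and> set_mset K \<subseteq> I then w J * w K * multi_ad K (\<Phi> J) 1 else 0)"
    for J K
  have \<Phi>: "linear_on I (\<Phi> J)" "dop I n (\<Phi> J)" if "set_mset J \<subseteq> I" for J
    using multi_ad_first[OF assms that polys_1] by (simp_all add: \<Phi>_def[abs_def])
  have \<Phi>_polys: "\<Phi> J q \<in> polys I" if "set_mset J \<subseteq> I" "q \<in> polys I" for J q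
    unfolding \<Phi>_def using that bilinear by (intro multi_ad_polys) (auto simp: bilinear_on_def)
  have "c J K \<in> polys I" for J K
    by (simp add: c_def w_def polys_mult multi_ad_polys \<Phi>_polys)
  moreover have "c J K \<noteq> 0 \<longrightarrow> set_mset J \<subseteq> I \<and> set_mset K \<subseteq> I" for J K
    by (simp add: c_def)
  moreover have "size J + size K \<le> n + n" if "c J K \<noteq> 0" for J K
  proof -
    have J: "set_mset J \<subseteq> I" and K: "set_mset K \<subseteq> I" and 0: "multi_ad K (\<Phi> J) 1 \<noteq> 0"
      using that by (auto simp: c_def split: if_splits)
    have "size K < n"
      using dop_multi_ad_eq_0[OF \<Phi>(2)[OF J] _ K polys_1] 0 by (meson not_le)
    moreover have "size J < n"
    proof (rule ccontr)
      assume "\<not> size J < n"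
      \<comment> \<open>Too many commutators in the first argument kill \<open>\<Phi> J\<close> as a
        whole, and with it all its Taylor coefficients.\<close>
      then have "\<Phi> J q = 0" if "q \<in> polys I" for q
        unfolding \<Phi>_def using bidop that J
        by (intro dop_multi_ad_eq_0[of I n]) (auto simp: bidop_def)
      then have "dop I 0 (\<Phi> J)" by simp
      from dop_multi_ad_eq_0[OF this _ K polys_1] 0 show False by simp
    qed
    ultimately show ?thesis by simp
  qed
  moreover have "\<phi> p q = Sum_any (\<lambda>(J, K). c J K * multi_deriv J p * multi_deriv K q)"
    if p: "p \<in> polys I" and q: "q \<in> polys I" for p q
  proof -
    have "\<phi> p q = Sum_any (\<lambda>J. if set_mset J \<subseteq> I then w J * \<Phi> J q * multi_deriv J p else 0)"
      unfolding w_def \<Phi>_def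
      by (rule taylor_expansion_polys[OF _ p]) (use q bilinear in \<open>simp add: bilinear_on_def\<close>)
    also have "\<dots> = Sum_any (\<lambda>J. Sum_any (\<lambda>K. c J K * multi_deriv J p * multi_deriv K q))"
    proof (rule arg_cong[of _ _ Sum_any], rule ext)
      fix J
      show "(if set_mset J \<subseteq> I then w J * \<Phi> J q * multi_deriv J p else 0) =
          Sum_any (\<lambda>K. c J K * multi_deriv J p * multi_deriv K q)"
      proof (cases "set_mset J \<subseteq> I")
        case True
        let ?g = "\<lambda>K. if set_mset K \<subseteq> I then w K * multi_ad K (\<Phi> J) 1 * multi_deriv K q else 0"
        have "w J * \<Phi> J q * multi_deriv J p = (w J * multi_deriv J p) * Sum_any ?g"
          unfolding w_def taylor_expansion_polys[OF \<Phi>(1)[OF True] q, symmetric] by (simp only: ac_simps)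
        also have "\<dots> = Sum_any (\<lambda>K. (w J * multi_deriv J p) * ?g K)"
          by (intro Sum_any_right_distrib finite_subset[OF _ finite_multi_deriv_nonzero[of q]])
             (auto split: if_splits)
        also have "\<dots> = Sum_any (\<lambda>K. c J K * multi_deriv J p * multi_deriv K q)"
          by (rule arg_cong[of _ _ Sum_any], rule ext) (simp add: c_def True ac_simps)
        finally show ?thesis using True by simp
      qed (simp add: c_def)
    qed
    \<comment> \<open>The double sum merges because its support lies in a product of two finite
      sets, the multi-indices with non-zero derivatives of \<open>p\<close> and of
      \<open>q\<close>.\<close>
    also have "\<dots> = Sum_any (\<lambda>(J, K). c J K * multi_deriv J p * multi_deriv K q)"
      by (rule Sum_any.cartesian_product[OF
            finite_cartesian_product[OF finite_multi_deriv_nonzero[of p] finite_multi_deriv_nonzero[of q]]])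
         auto
    finally show ?thesis .
  qed
  ultimately show ?thesis
    unfolding differential_operator2_def by (intro exI[of _ c]) blast
qed

text \<open>The coefficients at h^k of a product with unit 1 that satisfies the normalisation. The
  latter is stated for finite sets \<open>V\<close> of variables, so that it makes sense for
  infinite \<open>I\<close>.\<close>

locale normalized_cochains =
  fixes I :: "'i set"
    and \<pi> :: "nat \<Rightarrow> ('i, 'f::field_char_0) mpoly \<Rightarrow> ('i, 'f) mpoly \<Rightarrow> ('i, 'f) mpoly"
  assumes bilinear: "bilinear_on I (\<pi> k)"
    and zeroth: "p \<in> polys I \<Longrightarrow> q \<in> polys I \<Longrightarrow> \<pi> 0 p q = p * q"
    and assoc: "p \<in> polys I \<Longrightarrow> q \<in> polys I \<Longrightarrow> r \<in> polys I \<Longrightarrow>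
      (\<Sum>i\<le>k. \<pi> i (\<pi> (k - i) p q) r) = (\<Sum>i\<le>k. \<pi> i p (\<pi> (k - i) q r))"
    and unit: "k > 0 \<Longrightarrow> p \<in> polys I \<Longrightarrow> \<pi> k 1 p = 0"
    and euler: "k > 0 \<Longrightarrow> finite V \<Longrightarrow> V \<subseteq> I \<Longrightarrow> p \<in> polys V \<Longrightarrow>
      (\<Sum>i\<in>V. \<pi> k (var i) (partial_deriv i p)) = 0"
begin

lemma linear1: "p \<in> polys I \<Longrightarrow> linear_on I (\<pi> k p)"
  and linear2: "p \<in> polys I \<Longrightarrow> linear_on I (\<lambda>q. \<pi> k q p)"
  and closed: "p \<in> polys I \<Longrightarrow> q \<in> polys I \<Longrightarrow> \<pi> k p q \<in> polys I"
  using bilinear by (auto simp: bilinear_on_def)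

text \<open>The terms of associativity at h^k that involve only cochains of index strictly between 0
  and \<open>k\<close>.\<close>

definition obstruction where
  "obstruction k p q r = (\<Sum>i\<in>{0<..<k}. \<pi> i (\<pi> (k - i) p q) r - \<pi> i p (\<pi> (k - i) q r))"

text \<open>The terms with index 0 or \<open>k\<close> in the associativity equation form the
  Hochschild coboundary of \<open>\<pi> k\<close>, since \<open>\<pi> 0\<close> is the ordinary
  product.\<close>

lemma hochschild_obstruction:
  assumes "k > 0" "p \<in> polys I" "q \<in> polys I" "r \<in> polys I"
  shows "obstruction k p q r = p * \<pi> k q r - \<pi> k (p * q) r + \<pi> k p (q * r) - \<pi> k p q * r"
proof -
  have split: "(\<Sum>i\<le>k. f i) = f 0 + (f k + (\<Sum>i\<in>{0<..<k}. f i))" for f :: "nat \<Rightarrow> ('i, 'f) mpoly"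
  proof -
    have "{..k} = insert 0 (insert k {0<..<k})" using assms(1) by auto
    then show ?thesis using assms(1) by simp
  qed
  have rearrange: "e = c - b + d - a" if "e = s1 - s2" "a + (b + s1) = c + (d + s2)"
    for a b c d e s1 s2 :: "('i, 'f) mpoly"
  proof -
    have "s1 = c + (d + s2) - (a + b)"
      unfolding eq_diff_eq that(2)[symmetric] by (simp only: ac_simps)
    then show ?thesis unfolding that(1) by simp
  qed
  have "obstruction k p q r =
      (\<Sum>i\<in>{0<..<k}. \<pi> i (\<pi> (k - i) p q) r) - (\<Sum>i\<in>{0<..<k}. \<pi> i p (\<pi> (k - i) q r))"
    by (simp add: obstruction_def sum_subtractf)
  moreover have "\<pi> k p q * r + (\<pi> k (p * q) r + (\<Sum>i\<in>{0<..<k}. \<pi> i (\<pi> (k - i) p q) r)) =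
      p * \<pi> k q r + (\<pi> k p (q * r) + (\<Sum>i\<in>{0<..<k}. \<pi> i p (\<pi> (k - i) q r)))"
    using assoc[OF assms(2-4), of k] assms unfolding split by (simp add: zeroth closed)
  ultimately show ?thesis by (rule rearrange)
qed

text \<open>Both cochains in each term have index below \<open>k\<close>, so every term is a
  composition of operators of known order. The last and the middle argument are treated because the
  first one will always be a variable.\<close>

lemma dop_obstruction:
  assumes lower: "\<And>i. i < k \<Longrightarrow> bidop I N (\<pi> i)" and p: "p \<in> polys I" and q: "q \<in> polys I"
  shows "dop I (N + N) (obstruction k p q)"
    and "dop I (N + N) (\<lambda>r. obstruction k p r q)"
proof -
  have l1: "dop I N (\<pi> i p)" and l2: "dop I N (\<lambda>q. \<pi> i q p)" if "i < k" "p \<in> polys I" for i p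
    using lower that by (auto simp: bidop_def)
  have "dop I (N + N) (\<lambda>r. \<pi> i (\<pi> (k - i) p q) r - \<pi> i p (\<pi> (k - i) q r))" if i: "i \<in> {0<..<k}" for i
    using i p q
    by (intro dop_diff dop_comp[of I "\<pi> i p"] linear1 l1 dop_mono[of I N "\<pi> i (\<pi> (k - i) p q)"] closed) auto
  then show "dop I (N + N) (obstruction k p q)"
    unfolding obstruction_def[abs_def] by (rule dop_sum)
  have "dop I (N + N) (\<lambda>r. \<pi> i (\<pi> (k - i) p r) q - \<pi> i p (\<pi> (k - i) r q))" if i: "i \<in> {0<..<k}" for i
    using i p q
    by (intro dop_diff dop_comp[of I "\<lambda>r. \<pi> i r q"] dop_comp[of I "\<pi> i p"] linear1 linear2 l1 l2 closed) auto
  then show "dop I (N + N) (\<lambda>r. obstruction k p r q)"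
    unfolding obstruction_def by (rule dop_sum)
qed

text \<open>The bound arises as N + N for the obstruction plus 2 for the composition with a
  derivative; \<open>dop_if_dop_ad_euler\<close> then passes it on to D_j. It is the same for all
  \<open>j\<close>.\<close>

lemma dop_generator:
  assumes k: "k > 0" and N: "N \<ge> 1" and lower: "\<And>i. i < k \<Longrightarrow> bidop I N (\<pi> i)" and j: "j \<in> I"
  shows "dop I (N + N + 2) (\<pi> k (var j))"
proof -
  define D where "D i = \<pi> k (var i)" for i
  define U where "U i = (\<lambda>r. ad j (D i) r - ad i (D j) r)" for i
  have lin: "linear_on I (D i)" if "i \<in> I" for i
    using that by (simp add: D_def linear1 polys_var)
  have linU: "linear_on I (U i)" if "i \<in> I" for i
    unfolding U_def using that j by (intro linear_on_diff_fun linear_on_ad lin)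
  \<comment> \<open>Antisymmetrising the cocycle equation in two generators eliminates the unknown
    \<open>\<pi> k (x_i * x_j) r\<close>.\<close>
  have U: "dop I (N + N) (U i)" if i: "i \<in> I" for i
  proof (rule dop_cong)
    show "dop I (N + N) (\<lambda>r. obstruction k (var i) (var j) r - obstruction k (var j) (var i) r +
        (\<pi> k (var i) (var j) - \<pi> k (var j) (var i)) * r)"
      using i j N by (intro dop_add dop_diff dop_obstruction(1) lower dop_multiplication polys_var) auto
    show "U i r = obstruction k (var i) (var j) r - obstruction k (var j) (var i) r +
        (\<pi> k (var i) (var j) - \<pi> k (var j) (var i)) * r" if "r \<in> polys I" for r
      using i j that k by (simp add: U_def D_def ad_def hochschild_obstruction polys_var algebra_simps)
  qed
  have "dop I (N + N + 2) (D j)"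
  \<comment> \<open>Restricting to finitely many variables makes the Euler sum finite;
    \<open>V\<close> has to contain \<open>j\<close> for x_j p to be an admissible argument.\<close>
  proof (rule dop_if_finite_vars[of "{j}"])
    fix V :: "'i set"
    assume V: "finite V" "{j} \<subseteq> V" "V \<subseteq> I"
    show "dop V (N + N + 2) (D j)"
    proof (rule dop_if_dop_ad_euler[of _ _ _ 0])
      show "finite V" by fact
      show "linear_on V (D j)" using lin[OF j] V(3) by (rule linear_on_mono)
      have "dop V (N + N + 2) (\<lambda>p. - (\<Sum>i\<in>V. U i (partial_deriv i p)))"
        using V by (intro dop_uminus dop_sum dop_comp dop_partial_deriv polys_partial_deriv
            linear_on_mono[OF linU] dop_mono_vars[OF U]) auto
      then show "dop V (N + N + 2) (\<lambda>p. const_poly (of_nat (Suc 0)) * D j p + ad_euler V (D j) p)"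
      proof (rule dop_cong)
        fix p :: "('i, 'f) mpoly"
        assume p: "p \<in> polys V"
        then have pI: "p \<in> polys I" using polys_mono[OF V(3)] by blast
        have xp: "var j * p \<in> polys V" using p V(2) by (simp add: polys_mult polys_var)
        \<comment> \<open>The normalisation at x_j p, from which x_j times the normalisation at p is
          subtracted below. The outcome is \<Sum>_i [D_i, x_j] \<partial>_i = - D_j, and exchanging
          \<open>i\<close> and \<open>j\<close> in the commutator costs U_i.\<close>
        have "0 = (\<Sum>i\<in>V. D i (partial_deriv i (var j * p)))"
          using euler[OF k V(1,3) xp] by (simp add: D_def)
        also have "\<dots> = (\<Sum>i\<in>V. D i (var j * partial_deriv i p) + (if i = j then D i p else 0))"
        proof (rule sum.cong)
          fix i assume "i \<in> V"
          then have i: "i \<in> I" using V by blast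
          have "var j * partial_deriv i p \<in> polys I"
            using j pI by (intro polys_mult polys_var polys_partial_deriv)
          then show "D i (partial_deriv i (var j * p)) =
              D i (var j * partial_deriv i p) + (if i = j then D i p else 0)"
            using linear_on_add[OF lin[OF i] _ pI] by (cases "i = j") (simp_all add: partial_deriv_var_mult)
        qed simp
        also have "\<dots> = (\<Sum>i\<in>V. D i (var j * partial_deriv i p)) + D j p"
          using V by (simp add: sum.distrib)
        finally have 1: "(\<Sum>i\<in>V. D i (var j * partial_deriv i p)) + D j p = 0" ..
        have 2: "(\<Sum>i\<in>V. D i (partial_deriv i p)) = 0"
          using euler[OF k V(1,3) p] by (simp add: D_def)
        have "(\<Sum>i\<in>V. ad j (D i) (partial_deriv i p)) =
            (\<Sum>i\<in>V. D i (var j * partial_deriv i p)) - var j * (\<Sum>i\<in>V. D i (partial_deriv i p))"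
          by (simp add: ad_def sum_subtractf sum_distrib_left)
        then have "(\<Sum>i\<in>V. ad j (D i) (partial_deriv i p)) = - D j p"
          using 1 2 by (simp add: eq_neg_iff_add_eq_0)
        then show "const_poly (of_nat (Suc 0)) * D j p + ad_euler V (D j) p =
            - (\<Sum>i\<in>V. U i (partial_deriv i p))"
          by (simp add: ad_euler_def U_def sum_subtractf)
      qed
    qed
  qed (use j in auto)
  then show ?thesis by (simp add: D_def)
qed

text \<open>With a variable x_i as first argument, the coboundary equation expresses \<pi>_k(x_i q,
  r) - x_i \<pi>_k(q, r) by generators and the obstruction. Read as a recursion in \<open>q\<close>
  it bounds the order in \<open>r\<close>; read as a formula for a commutator it bounds the order in
  \<open>q\<close>.\<close>

theorem bidop_cochain: "\<exists>n. bidop I n (\<pi> k)"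
proof (induction k rule: less_induct)
  case (less k)
  show ?case
  proof (cases "k = 0")
    case True
    have "bidop I 1 (\<pi> 0)"
      unfolding bidop_def
    proof (intro ballI conjI)
      fix p :: "('i, 'f) mpoly"
      assume p: "p \<in> polys I"
      have "dop I 1 (\<lambda>q. p * q)" by (rule dop_multiplication) simp
      then show "dop I 1 (\<pi> 0 p)" "dop I 1 (\<lambda>q. \<pi> 0 q p)"
        by (rule dop_cong, simp add: zeroth p mult.commute)+
    qed
    then show ?thesis using True by blast
  next
    case False
    then have k: "k > 0" by simp
    obtain f where f: "\<And>i. i < k \<Longrightarrow> bidop I (f i) (\<pi> i)" using less by metis
    \<comment> \<open>A common bound for the finitely many lower cochains; the successor ensures
      that \<open>N\<close> is at least 1.\<close>
    define N where "N = Suc (\<Sum>i<k. f i)"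
    have lower: "bidop I N (\<pi> i)" if "i < k" for i
      using f[OF that] member_le_sum[of i "{..<k}" f] that by (elim bidop_mono) (simp add: N_def)
    define M where "M = N + N + 2"
    have gen: "dop I M (\<pi> k (var i))" if "i \<in> I" for i
      unfolding M_def using k lower that by (intro dop_generator) (auto simp: N_def)
    have obs: "dop I M (obstruction k p q)" "dop I M (\<lambda>r. obstruction k p r q)"
      if "p \<in> polys I" "q \<in> polys I" for p q
      using dop_obstruction[of k N p q, OF lower that] dop_mono[of I "N + N" _ M] by (simp_all add: M_def)
    have mult: "dop I M (\<lambda>r. a * r)" for a
      by (rule dop_multiplication) (simp add: M_def)
    have ad: "\<pi> k (var i * q) r - var i * \<pi> k q r =
        \<pi> k (var i) (q * r) - \<pi> k (var i) q * r - obstruction k (var i) q r"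
      if "i \<in> I" "q \<in> polys I" "r \<in> polys I" for i q r
      using that k by (simp add: hochschild_obstruction polys_var)
    \<comment> \<open>The same \<open>M\<close> serves for all \<open>q\<close>: multiplying by x_i
      and adding operators bounded by \<open>M\<close> does not raise the bound. Constants are
      covered by the unit.\<close>
    have 1: "dop I M (\<pi> k q)" if "q \<in> polys I" for q
      using that
    proof (induction q rule: polys_induct)
      case (const c)
      show ?case
        by (rule dop_cong[OF dop_0]) (simp add: linear_on_const[OF linear2] unit k)
    next
      case (add p q)
      from dop_add[OF add(3,4)] show ?case
        by (rule dop_cong) (simp add: linear_on_add[OF linear2] add)
    next
      case (var i q)
      have "dop I M (\<lambda>r. var i * \<pi> k q r + (\<pi> k (var i) (q * r) - \<pi> k (var i) q * r - obstruction k (var i) q r))"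
        by (intro dop_add dop_diff dop_mult[OF var(3)] dop_premult[OF gen] obs mult polys_var var)
      then show ?case
        by (rule dop_cong) (use ad[of i q] var in \<open>simp add: algebra_simps\<close>)
    qed
    \<comment> \<open>Here the commutator itself is bounded by \<open>M\<close>, hence the
      successor.\<close>
    have 2: "dop I (Suc M) (\<lambda>q. \<pi> k q r)" if r: "r \<in> polys I" for r
    proof -
      have "dop I M (ad i (\<lambda>q. \<pi> k q r))" if i: "i \<in> I" for i
      proof (rule dop_cong)
        show "dop I M (\<lambda>q. \<pi> k (var i) (r * q) - r * \<pi> k (var i) q - obstruction k (var i) q r)"
          by (intro dop_diff dop_mult[OF gen] dop_premult[OF gen] obs polys_var r i)
        show "ad i (\<lambda>q. \<pi> k q r) q = \<pi> k (var i) (r * q) - r * \<pi> k (var i) q - obstruction k (var i) q r"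
          if "q \<in> polys I" for q
          using ad[OF i that r] by (simp add: ad_def mult.commute)
      qed
      then show ?thesis by simp
    qed
    have "bidop I (Suc M) (\<pi> k)"
      unfolding bidop_def using 1 2 by (auto simp del: dop.simps intro: dop_Suc)
    then show ?thesis by blast
  qed
qed

end

section \<open>Linear maps of power series\<close>

abbreviation cmul :: "'f::field \<Rightarrow> ('i, 'f) mpoly fps \<Rightarrow> ('i, 'f) mpoly fps" where
  "cmul c P \<equiv> fps_const (const_poly c) * P"

lemma scale_series_const: "scale_series (fps_const c) P = cmul c P"
  unfolding scale_series_def by (rule arg_cong[of _ _ "\<lambda>Q. Q * P"]) (simp add: fps_eq_iff)

lemma scale_series_X: "scale_series fps_X P = fps_X * P"
  unfolding scale_series_def by (rule arg_cong[of _ _ "\<lambda>Q. Q * P"]) (simp add: fps_eq_iff)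

lemma poly_series_nth: "P \<in> poly_series I \<Longrightarrow> P $ n \<in> polys I"
  by (simp add: poly_series_def)

lemma poly_series_const: "p \<in> polys I \<Longrightarrow> fps_const p \<in> poly_series I"
  by (simp add: poly_series_def)

lemma poly_series_0 [simp]: "0 \<in> poly_series I"
  by (simp add: poly_series_def)

lemma poly_series_1 [simp]: "1 \<in> poly_series I"
  by (simp add: poly_series_def)

lemma poly_series_add: "P \<in> poly_series I \<Longrightarrow> Q \<in> poly_series I \<Longrightarrow> P + Q \<in> poly_series I"
  by (simp add: poly_series_def polys_add)

lemma poly_series_diff: "P \<in> poly_series I \<Longrightarrow> Q \<in> poly_series I \<Longrightarrow> P - Q \<in> poly_series I"
  by (simp add: poly_series_def polys_diff)

lemma poly_series_mult: "P \<in> poly_series I \<Longrightarrow> Q \<in> poly_series I \<Longrightarrow> P * Q \<in> poly_series I"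
  by (simp add: poly_series_def fps_mult_nth polys_sum polys_mult)

lemma poly_series_cmul: "P \<in> poly_series I \<Longrightarrow> cmul c P \<in> poly_series I"
  by (simp add: poly_series_def polys_mult)

lemma poly_series_sum: "(\<And>x. x \<in> B \<Longrightarrow> f x \<in> poly_series I) \<Longrightarrow> sum f B \<in> poly_series I"
  by (induction B rule: infinite_finite_induct) (simp_all add: poly_series_add)

lemma poly_series_shift: "P \<in> poly_series I \<Longrightarrow> fps_shift n P \<in> poly_series I"
  by (simp add: poly_series_def)

lemma poly_series_X_mult: "P \<in> poly_series I \<Longrightarrow> fps_X * P \<in> poly_series I"
  by (simp add: poly_series_def)

lemma poly_series_scale: "P \<in> poly_series I \<Longrightarrow> scale_series a P \<in> poly_series I"
  unfolding scale_series_def by (rule poly_series_mult) (simp_all add: poly_series_def)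

lemma fps_split: "P = fps_const (P $ 0) + fps_X * fps_shift 1 P" for P :: "'a::comm_ring_1 fps"
  by (simp add: fps_eq_iff)

section \<open>Maps that are linear over the power series in h\<close>

context
  fixes I :: "'i set" and G :: "('i, 'f::field) mpoly fps \<Rightarrow> ('i, 'f) mpoly fps"
  assumes G: "series_linear I G"
begin

lemma series_linear_closed: "P \<in> poly_series I \<Longrightarrow> G P \<in> poly_series I"
  using G by (simp add: series_linear_def)

lemma series_linear_add:
  "P \<in> poly_series I \<Longrightarrow> Q \<in> poly_series I \<Longrightarrow> G (P + Q) = G P + G Q"
  using G by (simp add: series_linear_def)

lemma series_linear_scale: "P \<in> poly_series I \<Longrightarrow> G (scale_series a P) = scale_series a (G P)"
  using G by (simp add: series_linear_def)

lemma series_linear_cmul: "P \<in> poly_series I \<Longrightarrow> G (cmul c P) = cmul c (G P)"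
  using series_linear_scale[of P "fps_const c"] by (simp add: scale_series_const)

lemma series_linear_X: "P \<in> poly_series I \<Longrightarrow> G (fps_X * P) = fps_X * G P"
  using series_linear_scale[of P fps_X] by (simp add: scale_series_X)

lemma series_linear_0: "G 0 = 0"
  using series_linear_cmul[of 0 0] by simp

lemma series_linear_sum:
  "(\<And>x. x \<in> B \<Longrightarrow> f x \<in> poly_series I) \<Longrightarrow> G (sum f B) = (\<Sum>x\<in>B. G (f x))"
  by (induction B rule: infinite_finite_induct)
     (simp_all add: series_linear_0 series_linear_add poly_series_sum)

lemma series_linear_split:
  assumes "P \<in> poly_series I"
  shows "G P = G (fps_const (P $ 0)) + fps_X * G (fps_shift 1 P)"
proof -
  have "G P = G (fps_const (P $ 0) + fps_X * fps_shift 1 P)"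
    using fps_split[of P] by simp
  also have "\<dots> = G (fps_const (P $ 0)) + G (fps_X * fps_shift 1 P)"
    using assms by (intro series_linear_add poly_series_const poly_series_nth poly_series_X_mult poly_series_shift)
  finally show ?thesis
    using assms by (simp add: series_linear_X poly_series_shift)
qed

text \<open>This is h-adic continuity: splitting P = P_0 + h P' repeatedly shows that the
  coefficient at h^k depends only on P_0, ..., P_k, and that the values on A determine the
  map.\<close>

lemma series_linear_nth:
  "P \<in> poly_series I \<Longrightarrow> G P $ k = (\<Sum>i\<le>k. G (fps_const (P $ (k - i))) $ i)"
proof (induction k arbitrary: P)
  case 0
  then show ?case by (subst series_linear_split) simp_all
next
  case (Suc k)
  have "G P $ Suc k = G (fps_const (P $ 0)) $ Suc k + G (fps_shift 1 P) $ k"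
    using Suc.prems by (subst series_linear_split) simp_all
  also have "G (fps_shift 1 P) $ k = (\<Sum>i\<le>k. G (fps_const (P $ (Suc k - i))) $ i)"
    using Suc.IH[OF poly_series_shift[OF Suc.prems, of 1]] by (simp add: Suc_diff_le)
  finally show ?case by (simp add: add.commute)
qed

lemma series_linear_nth_0: "P \<in> poly_series I \<Longrightarrow> G P $ 0 = G (fps_const (P $ 0)) $ 0"
  by (simp add: series_linear_nth)

end

lemma series_linear_eqI:
  assumes "series_linear I G" "series_linear I H" "P \<in> poly_series I"
    and "\<And>p. p \<in> polys I \<Longrightarrow> G (fps_const p) = H (fps_const p)"
  shows "G P = H P"
  by (rule fps_ext)
     (simp add: series_linear_nth[OF assms(1,3)] series_linear_nth[OF assms(2,3)] assms(3,4) poly_series_nth)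

lemma series_linear_comp:
  "series_linear I G \<Longrightarrow> series_linear I H \<Longrightarrow> series_linear I (\<lambda>P. G (H P))"
  by (simp add: series_linear_def)

text \<open>The map is unitriangular: the coefficient of the image at h^k is P_k plus terms in
  earlier coefficients. A series in the kernel therefore vanishes coefficient by
  coefficient.\<close>

lemma inj_on_if_series_linear:
  assumes G: "series_linear I G" and 0: "\<And>p. p \<in> polys I \<Longrightarrow> G (fps_const p) $ 0 = p"
  shows "inj_on G (poly_series I)"
proof (rule inj_onI)
  fix P Q
  assume P: "P \<in> poly_series I" and Q: "Q \<in> poly_series I" and "G P = G Q"
  have D: "P - Q \<in> poly_series I" using P Q by (rule poly_series_diff)
  have "G P = G (P - Q) + G Q" using series_linear_add[OF G D Q] by simp
  then have GD: "G (P - Q) = 0" using \<open>G P = G Q\<close> by simp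
  have "(P - Q) $ k = 0" for k
  proof (induction k rule: less_induct)
    case (less k)
    have "{..k} = insert 0 {0<..k}" by auto
    then have "G (P - Q) $ k = G (fps_const ((P - Q) $ k)) $ 0 + (\<Sum>i\<in>{0<..k}. G (fps_const ((P - Q) $ (k - i))) $ i)"
      unfolding series_linear_nth[OF G D] by simp
    moreover have "(\<Sum>i\<in>{0<..k}. G (fps_const ((P - Q) $ (k - i))) $ i) = 0"
      by (rule sum.neutral) (auto simp: less.IH series_linear_0[OF G] simp del: fps_sub_nth)
    ultimately show ?case
      unfolding GD by (simp add: 0 poly_series_nth[OF D] del: fps_sub_nth)
  qed
  then show "P = Q" by (simp add: fps_eq_iff)
qed

text \<open>The preimage is found by successive approximation, one power of h at a time.\<close>

lemma surj_on_if_series_linear: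
  assumes G: "series_linear I G" and 0: "\<And>p. p \<in> polys I \<Longrightarrow> G (fps_const p) $ 0 = p"
  shows "G ` poly_series I = poly_series I"
proof
  show "G ` poly_series I \<subseteq> poly_series I"
    using series_linear_closed[OF G] by blast
next
  show "poly_series I \<subseteq> G ` poly_series I"
  proof
    fix P :: "('a, 'b) mpoly fps"
    assume P: "P \<in> poly_series I"
    \<comment> \<open>\<open>R n\<close> is the remainder after \<open>n\<close> coefficients of the
      preimage, divided by h^n. The shift loses nothing, since the difference has constant
      coefficient 0.\<close>
    define R where "R n = ((\<lambda>P. fps_shift 1 (P - G (fps_const (P $ 0)))) ^^ n) P" for n
    have R0: "R 0 = P" by (simp add: R_def)
    have RSuc: "R (Suc n) = fps_shift 1 (R n - G (fps_const (R n $ 0)))" for n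
      by (simp add: R_def)
    have R: "R n \<in> poly_series I" for n
      by (induction n)
         (simp_all add: R0 P RSuc poly_series_shift poly_series_diff series_linear_closed[OF G]
           poly_series_const poly_series_nth)
    define Q where "Q = Abs_fps (\<lambda>n. R n $ 0)"
    have Q: "fps_shift n Q \<in> poly_series I" for n
      using poly_series_nth[OF R] by (simp add: poly_series_def Q_def)
    \<comment> \<open>Only n = 0 is wanted, but the induction on \<open>k\<close> passes from
      \<open>n\<close> to n + 1.\<close>
    have "R n $ k = G (fps_shift n Q) $ k" for n k
    proof (induction k arbitrary: n)
      case 0
      show ?case
        using series_linear_nth_0[OF G Q[of n]] by (simp add: Q_def assms(2) poly_series_nth[OF R])
    next
      case (Suc k)
      have "G (fps_shift n Q) $ Suc k = G (fps_const (R n $ 0)) $ Suc k + G (fps_shift (Suc n) Q) $ k"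
      proof -
        have "fps_shift 1 (fps_shift n Q) = fps_shift (Suc n) Q" by (simp add: fps_eq_iff)
        moreover have "fps_shift n Q $ 0 = R n $ 0" by (simp add: Q_def)
        ultimately show ?thesis by (subst series_linear_split[OF G Q]) (simp del: fps_shift_nth)
      qed
      also have "G (fps_shift (Suc n) Q) $ k = R n $ Suc k - G (fps_const (R n $ 0)) $ Suc k"
        using Suc.IH[of "Suc n"] by (simp add: RSuc)
      finally show ?case by simp
    qed
    from this[of 0] have "P = G Q" by (simp add: fps_eq_iff R0)
    moreover have "Q \<in> poly_series I" using Q[of 0] by simp
    ultimately show "P \<in> G ` poly_series I" by blast
  qed
qed

lemma series_linear_inv_into:
  assumes G: "series_linear I G" and 0: "\<And>p. p \<in> polys I \<Longrightarrow> G (fps_const p) $ 0 = p"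
  defines "F \<equiv> inv_into (poly_series I) G"
  shows "P \<in> poly_series I \<Longrightarrow> F (G P) = P" and "P \<in> poly_series I \<Longrightarrow> G (F P) = P"
    and "series_linear I F" and "p \<in> polys I \<Longrightarrow> F (fps_const p) $ 0 = p"
proof -
  show FG: "F (G P) = P" if "P \<in> poly_series I" for P
    unfolding F_def using inj_on_if_series_linear[OF G 0] that by (rule inv_into_f_f)
  show GF: "G (F P) = P" if "P \<in> poly_series I" for P
    unfolding F_def using surj_on_if_series_linear[OF G 0] that by (intro f_inv_into_f) simp
  have F: "F P \<in> poly_series I" if "P \<in> poly_series I" for P
    unfolding F_def using surj_on_if_series_linear[OF G 0] that by (intro inv_into_into) simp
  show "series_linear I F"
    unfolding series_linear_def
  proof (intro conjI ballI allI F)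
    fix P Q :: "('a, 'b) mpoly fps" and a
    assume P: "P \<in> poly_series I"
    have "F (scale_series a (G (F P))) = scale_series a (F P)"
      unfolding series_linear_scale[OF G F[OF P], symmetric] by (intro FG poly_series_scale F P)
    then show "F (scale_series a P) = scale_series a (F P)" by (simp add: GF P)
    assume Q: "Q \<in> poly_series I"
    have "F (G (F P) + G (F Q)) = F P + F Q"
      unfolding series_linear_add[OF G F[OF P] F[OF Q], symmetric] by (intro FG poly_series_add F P Q)
    then show "F (P + Q) = F P + F Q" by (simp add: GF P Q)
  qed
  show "F (fps_const p) $ 0 = p" if p: "p \<in> polys I"
  proof -
    have Fp: "F (fps_const p) \<in> poly_series I" using p by (intro F poly_series_const)
    have "fps_const p $ 0 = G (F (fps_const p)) $ 0" using p by (simp add: GF poly_series_const)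
    also have "\<dots> = F (fps_const p) $ 0"
      unfolding series_linear_nth_0[OF G Fp] by (simp add: 0 poly_series_nth[OF Fp])
    finally show ?thesis by simp
  qed
qed

text \<open>The extension from A to A[[h]] dictated by \<open>series_linear_nth\<close>.\<close>

definition extend :: "(('i, 'f::field) mpoly \<Rightarrow> ('i, 'f) mpoly fps) \<Rightarrow> ('i, 'f) mpoly fps \<Rightarrow> ('i, 'f) mpoly fps" where
  "extend f P = Abs_fps (\<lambda>k. \<Sum>i\<le>k. f (P $ (k - i)) $ i)"

lemma sum_triangle_swap:
  "(\<Sum>i\<le>k. \<Sum>j\<le>k - i. f i j) = (\<Sum>j\<le>k. \<Sum>i\<le>k - j. f i j :: 'a::comm_monoid_add)" for k :: nat
  by (simp add: sum.Sigma)
     (rule sum.reindex_bij_witness[of _ "\<lambda>(i, j). (j, i)" "\<lambda>(i, j). (j, i)"], auto)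

lemma scale_series_nth: "scale_series a P $ k = (\<Sum>j\<le>k. const_poly (a $ j) * P $ (k - j))"
  by (simp add: scale_series_def fps_mult_nth atLeast0AtMost)

context
  fixes I :: "'i set" and f :: "('i, 'f::field) mpoly \<Rightarrow> ('i, 'f) mpoly fps"
  assumes closed: "\<And>p. p \<in> polys I \<Longrightarrow> f p \<in> poly_series I"
    and add: "\<And>p q. p \<in> polys I \<Longrightarrow> q \<in> polys I \<Longrightarrow> f (p + q) = f p + f q"
    and const: "\<And>c p. p \<in> polys I \<Longrightarrow> f (const_poly c * p) = cmul c (f p)"
begin

lemma extend_f_0: "f 0 = 0"
  using const[of 0 0] by simp

lemma extend_const: "extend f (fps_const p) = f p"
proof (rule fps_ext)
  fix k
  have "extend f (fps_const p) $ k = (\<Sum>i\<le>k. if i = k then f p $ k else 0)"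
    unfolding extend_def fps_nth_Abs_fps by (rule sum.cong) (auto simp: extend_f_0)
  then show "extend f (fps_const p) $ k = f p $ k" by simp
qed

lemma series_linear_extend: "series_linear I (extend f)"
  unfolding series_linear_def
proof (intro conjI ballI allI)
  fix P Q :: "('i, 'f) mpoly fps" and a
  assume P: "P \<in> poly_series I"
  then show "extend f P \<in> poly_series I"
    unfolding poly_series_def extend_def
    by (auto intro!: polys_sum poly_series_nth[OF closed])
  show "extend f (scale_series a P) = scale_series a (extend f P)"
  proof (rule fps_ext)
    fix k
    have f_sum: "f (\<Sum>j\<in>B. const_poly (a $ j) * P $ (n - j)) = (\<Sum>j\<in>B. cmul (a $ j) (f (P $ (n - j))))"
      if "finite B" for B n
      using that
      by (induction B rule: finite_induct)
         (simp_all add: extend_f_0 add const polys_sum polys_mult poly_series_nth[OF P])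
    have "extend f (scale_series a P) $ k =
        (\<Sum>i\<le>k. \<Sum>j\<le>k - i. const_poly (a $ j) * f (P $ (k - i - j)) $ i)"
      unfolding extend_def fps_nth_Abs_fps scale_series_nth f_sum[OF finite_atMost]
      by (simp only: fps_sum_nth fps_mult_left_const_nth)
    also have "\<dots> = (\<Sum>j\<le>k. \<Sum>i\<le>k - j. const_poly (a $ j) * f (P $ (k - i - j)) $ i)"
      by (rule sum_triangle_swap)
    also have "\<dots> = scale_series a (extend f P) $ k"
      by (simp add: scale_series_nth extend_def sum_distrib_left add.commute)
    finally show "extend f (scale_series a P) $ k = scale_series a (extend f P) $ k" .
  qed
  assume Q: "Q \<in> poly_series I"
  show "extend f (P + Q) = extend f P + extend f Q"
    by (rule fps_ext) (simp add: extend_def add poly_series_nth[OF P] poly_series_nth[OF Q] sum.distrib)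
qed

end

section \<open>The substitution h \<mapsto> -h\<close>

definition hneg :: "'a::comm_ring_1 fps \<Rightarrow> 'a fps" where
  "hneg P = Abs_fps (\<lambda>n. (-1) ^ n * P $ n)"

lemma hneg_nth [simp]: "hneg P $ n = (-1) ^ n * P $ n"
  by (simp add: hneg_def)

lemma hneg_hneg [simp]: "hneg (hneg P) = P"
  by (simp add: fps_eq_iff mult.assoc[symmetric] power_mult_distrib[symmetric])

lemma hneg_const [simp]: "hneg (fps_const p) = fps_const p"
  by (simp add: fps_eq_iff)

lemma hneg_add: "hneg (P + Q) = hneg P + hneg Q"
  by (simp add: fps_eq_iff distrib_left)

lemma hneg_mult: "hneg (P * Q) = hneg P * hneg Q"
proof (rule fps_ext)
  fix n
  have "(-1) ^ n * (P $ i * Q $ (n - i)) = ((-1) ^ i * P $ i) * ((-1) ^ (n - i) * Q $ (n - i))"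
    if "i \<le> n" for i
  proof -
    have "(-1 :: 'a) ^ n = (-1) ^ i * (-1) ^ (n - i)" using that by (simp flip: power_add)
    then show ?thesis by (simp only: ac_simps)
  qed
  then show "hneg (P * Q) $ n = (hneg P * hneg Q) $ n"
    by (simp add: fps_mult_nth sum_distrib_left)
qed

lemma hneg_sum: "hneg (sum f B) = (\<Sum>x\<in>B. hneg (f x))"
  by (simp add: fps_eq_iff fps_sum_nth sum_distrib_left)

lemma const_poly_minus_1_power: "const_poly ((-1) ^ n) = (-1) ^ n"
  by (induction n) simp_all

lemma hneg_scale_series:
  fixes P :: "('i, 'f::field) mpoly fps"
  shows "hneg (scale_series a P) = scale_series (hneg a) (hneg P)"
proof -
  have "hneg (Abs_fps (\<lambda>n. const_poly (a $ n))) = (Abs_fps (\<lambda>n. const_poly (hneg a $ n)) :: ('i, 'f) mpoly fps)"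
    by (simp add: fps_eq_iff const_poly_minus_1_power)
  then show ?thesis by (simp add: scale_series_def hneg_mult)
qed

lemma poly_series_hneg:
  assumes "P \<in> poly_series I"
  shows "hneg P \<in> poly_series I"
  unfolding poly_series_def mem_Collect_eq hneg_nth
proof
  fix n
  show "(-1) ^ n * P $ n \<in> polys I"
    unfolding const_poly_minus_1_power[symmetric] by (intro polys_mult polys_const poly_series_nth assms)
qed

text \<open>The substitution itself is only semilinear, but conjugating with it restores linearity.
  Identities involving \<open>hneg\<close> can thus be checked on A by
  \<open>series_linear_eqI\<close>.\<close>

lemma series_linear_hneg:
  assumes "series_linear I G"
  shows "series_linear I (\<lambda>P. hneg (G (hneg P)))"
  unfolding series_linear_def
  by (simp add: poly_series_hneg series_linear_closed[OF assms] hneg_add series_linear_add[OF assms]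
      hneg_scale_series series_linear_scale[OF assms])

section \<open>Symmetrisation\<close>

locale deformation =
  fixes I :: "'i set"
    and star :: "('i, 'f::field_char_0) mpoly fps \<Rightarrow> ('i, 'f) mpoly fps \<Rightarrow> ('i, 'f) mpoly fps"
      (infixl "\<star>" 70)
  assumes deformation: "formal_deformation I star"
begin

lemma star_linear1: "P \<in> poly_series I \<Longrightarrow> series_linear I (\<lambda>Q. P \<star> Q)"
  and star_linear2: "Q \<in> poly_series I \<Longrightarrow> series_linear I (\<lambda>P. P \<star> Q)"
  and star_assoc: "P \<in> poly_series I \<Longrightarrow> Q \<in> poly_series I \<Longrightarrow> R \<in> poly_series I \<Longrightarrow>
    (P \<star> Q) \<star> R = P \<star> (Q \<star> R)"
  using deformation by (simp_all add: formal_deformation_def series_bilinear_def)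

lemma star_closed: "P \<in> poly_series I \<Longrightarrow> Q \<in> poly_series I \<Longrightarrow> P \<star> Q \<in> poly_series I"
  using star_linear1 by (rule series_linear_closed)

lemma star_nth_0:
  assumes "P \<in> poly_series I" "Q \<in> poly_series I"
  shows "(P \<star> Q) $ 0 = P $ 0 * Q $ 0"
proof -
  have p: "P $ 0 \<in> polys I" and q: "Q $ 0 \<in> polys I"
    using assms by (auto intro: poly_series_nth)
  have "(P \<star> Q) $ 0 = (P \<star> fps_const (Q $ 0)) $ 0"
    by (rule series_linear_nth_0[OF star_linear1[OF assms(1)] assms(2)])
  also have "\<dots> = (fps_const (P $ 0) \<star> fps_const (Q $ 0)) $ 0"
    by (rule series_linear_nth_0[OF star_linear2[OF poly_series_const[OF q]] assms(1)])
  also have "\<dots> = P $ 0 * Q $ 0"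
    using deformation p q by (simp add: formal_deformation_def)
  finally show ?thesis .
qed

lemma bilinear_cochain: "bilinear_on I (cochain star k)"
  unfolding bilinear_on_def linear_on_def cochain_def
proof (intro ballI conjI allI)
  fix p q r :: "('i, 'f) mpoly" and c
  assume p: "p \<in> polys I" and q: "q \<in> polys I"
  note p' = poly_series_const[OF p] and q' = poly_series_const[OF q]
  show "(fps_const p \<star> fps_const q) $ k \<in> polys I"
    by (intro poly_series_nth star_closed p' q')
  show "(fps_const p \<star> fps_const (const_poly c * q)) $ k = const_poly c * (fps_const p \<star> fps_const q) $ k"
    using series_linear_cmul[OF star_linear1[OF p'] q', of c] by simp
  show "(fps_const (const_poly c * q) \<star> fps_const p) $ k = const_poly c * (fps_const q \<star> fps_const p) $ k"
    using series_linear_cmul[OF star_linear2[OF p'] q', of c] by simp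
  assume "r \<in> polys I"
  note r' = poly_series_const[OF this]
  show "(fps_const p \<star> fps_const (q + r)) $ k = (fps_const p \<star> fps_const q) $ k + (fps_const p \<star> fps_const r) $ k"
    using series_linear_add[OF star_linear1[OF p'] q' r'] by simp
  show "(fps_const (q + r) \<star> fps_const p) $ k = (fps_const q \<star> fps_const p) $ k + (fps_const r \<star> fps_const p) $ k"
    using series_linear_add[OF star_linear2[OF p'] q' r'] by simp
qed

lemma cochain_0: "p \<in> polys I \<Longrightarrow> q \<in> polys I \<Longrightarrow> cochain star 0 p q = p * q"
  by (simp add: cochain_def star_nth_0 poly_series_const)

lemma cochain_assoc:
  assumes "p \<in> polys I" "q \<in> polys I" "r \<in> polys I"
  shows "(\<Sum>i\<le>k. cochain star i (cochain star (k - i) p q) r) =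
    (\<Sum>i\<le>k. cochain star i p (cochain star (k - i) q r))"
proof -
  note c = assms[THEN poly_series_const]
  have "((fps_const p \<star> fps_const q) \<star> fps_const r) $ k = (fps_const p \<star> (fps_const q \<star> fps_const r)) $ k"
    by (simp only: star_assoc[OF c])
  then show ?thesis
    unfolding cochain_def series_linear_nth[OF star_linear2[OF c(3)] star_closed[OF c(1,2)]]
      series_linear_nth[OF star_linear1[OF c(1)] star_closed[OF c(2,3)]] .
qed

text \<open>The polynomial 1 is the unit only modulo h, but \<star>-multiplication by it from either
  side is the identity modulo h and hence bijective. Cancelling 1 makes the solution of 1 \<star> u
  = 1 a left unit and that of v \<star> 1 = 1 a right unit, so both coincide.\<close>

lemma unit_exists: "\<exists>u \<in> poly_series I. \<forall>P \<in> poly_series I. u \<star> P = P \<and> P \<star> u = P"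
proof -
  have L: "series_linear I (\<lambda>P. 1 \<star> P)" and R: "series_linear I (\<lambda>P. P \<star> 1)"
    by (simp_all add: star_linear1 star_linear2)
  have L0: "(1 \<star> fps_const p) $ 0 = p" and R0: "(fps_const p \<star> 1) $ 0 = p" if "p \<in> polys I" for p
    using that by (simp_all add: star_nth_0 poly_series_const)
  obtain u where u: "u \<in> poly_series I" "1 \<star> u = 1"
    using surj_on_if_series_linear[OF L L0] poly_series_1[of I] by (metis (lifting) imageE)
  obtain v where v: "v \<in> poly_series I" "v \<star> 1 = 1"
    using surj_on_if_series_linear[OF R R0] poly_series_1[of I] by (metis (lifting) imageE)
  have uP: "u \<star> P = P" if P: "P \<in> poly_series I" for P
  proof (rule inj_onD[OF inj_on_if_series_linear[OF L L0]])
    show "1 \<star> (u \<star> P) = 1 \<star> P"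
      using star_assoc[OF poly_series_1 u(1) P] u(2) by simp
  qed (use P u star_closed in auto)
  have Pv: "P \<star> v = P" if P: "P \<in> poly_series I" for P
  proof (rule inj_onD[OF inj_on_if_series_linear[OF R R0]])
    show "(P \<star> v) \<star> 1 = P \<star> 1"
      using star_assoc[OF P v(1) poly_series_1] v(2) by simp
  qed (use P v star_closed in auto)
  have "u = v" using uP[OF v(1)] Pv[OF u(1)] by simp
  then show ?thesis using u(1) uP Pv by blast
qed

definition unit where
  "unit = (SOME u. u \<in> poly_series I \<and> (\<forall>P \<in> poly_series I. u \<star> P = P \<and> P \<star> u = P))"

lemma unit_closed: "unit \<in> poly_series I"
  and unit_left: "P \<in> poly_series I \<Longrightarrow> unit \<star> P = P"
  and unit_right: "P \<in> poly_series I \<Longrightarrow> P \<star> unit = P"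
  using someI_ex[of "\<lambda>u. u \<in> poly_series I \<and> (\<forall>P \<in> poly_series I. u \<star> P = P \<and> P \<star> u = P)"]
    unit_exists by (auto simp: unit_def Bex_def)

text \<open>\<open>sym n m\<close> is the average of the \<open>\<star>\<close>-products of the variables of a monomial \<open>m\<close> of degree \<open>n\<close>,
  taken over all orderings.\<close>

primrec sym :: "nat \<Rightarrow> ('i \<Rightarrow>\<^sub>0 nat) \<Rightarrow> ('i, 'f) mpoly fps" where
  "sym 0 m = unit"
| "sym (Suc n) m = cmul (1 / of_nat (Suc n)) (\<Sum>i \<in> Poly_Mapping.keys m.
     cmul (of_nat (Poly_Mapping.lookup m i))
       (fps_const (var i) \<star> sym n (m - Poly_Mapping.single i 1)))"

lemma sym_closed: "Poly_Mapping.keys m \<subseteq> I \<Longrightarrow> sym n m \<in> poly_series I"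
proof (induction n arbitrary: m)
  case 0
  then show ?case by (simp add: unit_closed)
next
  case (Suc n)
  have "fps_const (var i) \<star> sym n (m - Poly_Mapping.single i 1) \<in> poly_series I"
    if "i \<in> Poly_Mapping.keys m" for i
    using that Suc.prems order.trans[OF keys_diff_monomial Suc.prems]
    by (intro star_closed poly_series_const polys_var Suc.IH) auto
  then show ?case by (auto intro!: poly_series_cmul poly_series_sum)
qed

lemma sym_diff_closed: "Poly_Mapping.keys m \<subseteq> I \<Longrightarrow> sym n (m - k) \<in> poly_series I"
  by (rule sym_closed) (rule order.trans[OF keys_diff_monomial])

lemma sym_Suc_superset:
  assumes "finite V" "Poly_Mapping.keys m \<subseteq> V"
  shows "sym (Suc n) m = cmul (1 / of_nat (Suc n)) (\<Sum>i \<in> V.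
     cmul (of_nat (Poly_Mapping.lookup m i))
       (fps_const (var i) \<star> sym n (m - Poly_Mapping.single i 1)))"
  unfolding sym.simps using assms
  by (intro arg_cong[of _ _ "cmul _"] sum.mono_neutral_left) (auto simp: in_keys_iff)

lemma cmul_cmul: "cmul a (cmul b P) = cmul (a * b) P"
  by (simp add: mult.assoc[symmetric] fps_const_mult[symmetric] del: fps_const_mult)

lemma sum_star_sym:
  assumes "finite V" "Poly_Mapping.keys m \<subseteq> V"
  shows "(\<Sum>i\<in>V. cmul (of_nat (Poly_Mapping.lookup m i))
      (fps_const (var i) \<star> sym n (m - Poly_Mapping.single i 1))) = cmul (of_nat (Suc n)) (sym (Suc n) m)"
  unfolding sym_Suc_superset[OF assms] cmul_cmul using of_nat_neq_0[of n, where 'a = 'f]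
  by (simp del: of_nat_Suc)

text \<open>Modulo h all orderings have the same product, so their average is the monomial
  itself.\<close>

lemma sym_nth_0:
  "Poly_Mapping.keys m \<subseteq> I \<Longrightarrow> degm m = n \<Longrightarrow> sym n m $ 0 = Poly_Mapping.single m 1"
proof (induction n arbitrary: m)
  case 0
  have "unit $ 0 = 1"
    using star_nth_0[OF unit_closed poly_series_1] by (simp add: unit_left)
  moreover have "m = 0"
    using 0 by (intro poly_mapping_eqI) (auto simp: degm_def in_keys_iff)
  ultimately show ?case by simp
next
  case (Suc n)
  have "(cmul (of_nat (Poly_Mapping.lookup m i))
      (fps_const (var i) \<star> sym n (m - Poly_Mapping.single i 1))) $ 0 =
      Poly_Mapping.single m (of_nat (Poly_Mapping.lookup m i))" if i: "i \<in> Poly_Mapping.keys m" for i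
  proof -
    have 1: "Poly_Mapping.lookup m i \<noteq> 0" and "i \<in> I" using i Suc.prems by (auto simp: in_keys_iff)
    have "sym n (m - Poly_Mapping.single i 1) $ 0 = Poly_Mapping.single (m - Poly_Mapping.single i 1) 1"
      using degm_diff_single[OF 1] Suc.prems order.trans[OF keys_diff_monomial Suc.prems(1)]
      by (intro Suc.IH) auto
    then have "(fps_const (var i) \<star> sym n (m - Poly_Mapping.single i 1)) $ 0 = Poly_Mapping.single m 1"
      using star_nth_0[OF poly_series_const[OF polys_var[OF \<open>i \<in> I\<close>]] sym_diff_closed[OF Suc.prems(1)]]
        monomial_split[OF 1] by (simp add: var_def mult_single)
    then show ?thesis by simp
  qed
  then have "sym (Suc n) m $ 0 = const_poly (1 / of_nat (Suc n)) *
      (\<Sum>i \<in> Poly_Mapping.keys m. Poly_Mapping.single m (of_nat (Poly_Mapping.lookup m i)))"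
    by (simp add: fps_sum_nth)
  \<comment> \<open>The weights add up to the degree, which cancels the averaging factor.\<close>
  also have "(\<Sum>i \<in> Poly_Mapping.keys m. Poly_Mapping.single m (of_nat (Poly_Mapping.lookup m i) :: 'f)) =
      Poly_Mapping.single m (of_nat (Suc n))"
    unfolding Suc.prems(2)[symmetric] degm_def
    by (rule poly_mapping_eqI) (simp add: lookup_sum lookup_single when_def)
  finally show ?case using of_nat_neq_0[of n, where 'a = 'f] by (simp del: of_nat_Suc)
qed

section \<open>The symmetrisation map and its inverse\<close>

definition symmetrize_poly :: "('i, 'f) mpoly \<Rightarrow> ('i, 'f) mpoly fps" where
  "symmetrize_poly p = (\<Sum>m \<in> Poly_Mapping.keys p. cmul (Poly_Mapping.lookup p m) (sym (degm m) m))"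

lemma symmetrize_poly_superset:
  assumes "finite B" "Poly_Mapping.keys p \<subseteq> B"
  shows "symmetrize_poly p = (\<Sum>m \<in> B. cmul (Poly_Mapping.lookup p m) (sym (degm m) m))"
  unfolding symmetrize_poly_def using assms
  by (intro sum.mono_neutral_left) (auto simp: in_keys_iff)

lemma symmetrize_poly_single: "symmetrize_poly (Poly_Mapping.single m c) = cmul c (sym (degm m) m)"
  by (subst symmetrize_poly_superset[of "{m}"]) simp_all

lemma symmetrize_poly_closed: "p \<in> polys I \<Longrightarrow> symmetrize_poly p \<in> poly_series I"
  unfolding symmetrize_poly_def polys_def
  by (intro poly_series_sum poly_series_cmul sym_closed) simp

lemma symmetrize_poly_add: "symmetrize_poly (p + q) = symmetrize_poly p + symmetrize_poly q"
proof -
  let ?B = "Poly_Mapping.keys p \<union> Poly_Mapping.keys q"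
  have "symmetrize_poly r = (\<Sum>m \<in> ?B. cmul (Poly_Mapping.lookup r m) (sym (degm m) m))"
    if "r \<in> {p, q, p + q}" for r
    using that Poly_Mapping.keys_add[of p q] by (intro symmetrize_poly_superset) auto
  then show ?thesis
    by (simp add: lookup_add distrib_right sum.distrib fps_const_add[symmetric] del: fps_const_add)
qed

lemma symmetrize_poly_const_mult: "symmetrize_poly (const_poly c * p) = cmul c (symmetrize_poly p)"
proof -
  have "symmetrize_poly (const_poly c * p) =
      (\<Sum>m \<in> Poly_Mapping.keys p. cmul (Poly_Mapping.lookup (const_poly c * p) m) (sym (degm m) m))"
    by (rule symmetrize_poly_superset) (auto simp: in_keys_iff)
  then show ?thesis
    unfolding symmetrize_poly_def[of p] sum_distrib_left cmul_cmul lookup_const_poly_mult .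
qed

lemma symmetrize_poly_nth_0: "p \<in> polys I \<Longrightarrow> symmetrize_poly p $ 0 = p"
proof (induction p rule: polys_induct_single)
  case (single m c)
  then show ?case by (simp add: symmetrize_poly_single sym_nth_0)
next
  case (add p q)
  then show ?case by (simp add: symmetrize_poly_add)
qed

definition symmetrize :: "('i, 'f) mpoly fps \<Rightarrow> ('i, 'f) mpoly fps" where
  "symmetrize = extend symmetrize_poly"

text \<open>A true inverse on \<open>poly_series I\<close>, as symmetrisation is the identity modulo
  h.\<close>

definition desymmetrize :: "('i, 'f) mpoly fps \<Rightarrow> ('i, 'f) mpoly fps" where
  "desymmetrize = inv_into (poly_series I) symmetrize"

lemma symmetrize_linear: "series_linear I symmetrize"
  unfolding symmetrize_def
  by (intro series_linear_extend symmetrize_poly_closed symmetrize_poly_add symmetrize_poly_const_mult)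

lemma symmetrize_const: "symmetrize (fps_const p) = symmetrize_poly p"
  unfolding symmetrize_def
  by (intro extend_const[of I] symmetrize_poly_closed symmetrize_poly_add symmetrize_poly_const_mult)

lemma symmetrize_const_nth_0: "p \<in> polys I \<Longrightarrow> symmetrize (fps_const p) $ 0 = p"
  by (simp add: symmetrize_const symmetrize_poly_nth_0)

lemmas symmetrize_closed = series_linear_closed[OF symmetrize_linear]

lemma desymmetrize_symmetrize: "P \<in> poly_series I \<Longrightarrow> desymmetrize (symmetrize P) = P"
  and symmetrize_desymmetrize: "P \<in> poly_series I \<Longrightarrow> symmetrize (desymmetrize P) = P"
  and desymmetrize_linear: "series_linear I desymmetrize"
  and desymmetrize_nth_0: "p \<in> polys I \<Longrightarrow> desymmetrize (fps_const p) $ 0 = p"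
  unfolding desymmetrize_def
  by (rule series_linear_inv_into[OF symmetrize_linear]; simp add: symmetrize_const_nth_0)+

lemmas desymmetrize_closed = series_linear_closed[OF desymmetrize_linear]

lemma symmetrize_1: "symmetrize 1 = unit"
proof -
  have "symmetrize (fps_const (Poly_Mapping.single 0 1)) = unit"
    unfolding symmetrize_const symmetrize_poly_single by (simp add: degm_def)
  then show ?thesis by simp
qed

lemma symmetrize_var:
  assumes "i \<in> I"
  shows "symmetrize (fps_const (var i)) = fps_const (var i)"
proof -
  have "sym (Suc 0) (Poly_Mapping.single i 1) = fps_const (var i)"
    using assms by (simp add: unit_right poly_series_const polys_var const_poly_of_nat)
  then show ?thesis
    by (simp add: symmetrize_const var_def symmetrize_poly_single degm_def del: sym.simps)
qed

text \<open>On a monomial this is the recursion that defines \<open>sym\<close>: the sum of m_i x_i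
  \<star> sym (m - e_i) is deg m times sym m, and deg m is the eigenvalue of the Euler operator on
  the right. Pulled back, it becomes the normalisation.\<close>

lemma symmetrize_euler:
  assumes "finite V" "V \<subseteq> I" "p \<in> polys V"
  shows "(\<Sum>i\<in>V. fps_const (var i) \<star> symmetrize (fps_const (partial_deriv i p))) =
    symmetrize (fps_const (\<Sum>i\<in>V. var i * partial_deriv i p))"
  using assms(3)
proof (induction p rule: polys_induct_single)
  case (single m c)
  let ?m = "\<lambda>i. m - Poly_Mapping.single i 1"
  have mI: "Poly_Mapping.keys m \<subseteq> I" using single assms(2) by blast
  have "(\<Sum>i\<in>V. var i * partial_deriv i (Poly_Mapping.single m c)) =
      (\<Sum>i\<in>V. Poly_Mapping.single m (of_nat (Poly_Mapping.lookup m i) * c))"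
  proof (rule sum.cong)
    fix i
    show "var i * partial_deriv i (Poly_Mapping.single m c) =
        Poly_Mapping.single m (of_nat (Poly_Mapping.lookup m i) * c)"
      using monomial_split[of m i]
      by (cases "Poly_Mapping.lookup m i = 0") (simp_all add: partial_deriv_single var_def mult_single)
  qed simp
  also have "\<dots> = Poly_Mapping.single m (of_nat (degm m) * c)"
    unfolding degm_superset[OF assms(1) single]
    by (rule poly_mapping_eqI) (simp add: lookup_sum lookup_single when_def sum_distrib_right)
  finally have rhs: "symmetrize (fps_const (\<Sum>i\<in>V. var i * partial_deriv i (Poly_Mapping.single m c))) =
      cmul (of_nat (degm m) * c) (sym (degm m) m)"
    by (simp only: symmetrize_const symmetrize_poly_single)
  have lhs: "fps_const (var i) \<star> symmetrize (fps_const (partial_deriv i (Poly_Mapping.single m c))) =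
      cmul c (cmul (of_nat (Poly_Mapping.lookup m i)) (fps_const (var i) \<star> sym (degm (?m i)) (?m i)))"
    if "i \<in> V" for i
  proof -
    have "i \<in> I" using that assms(2) by blast
    then show ?thesis
      unfolding symmetrize_const partial_deriv_single symmetrize_poly_single cmul_cmul
      by (subst series_linear_cmul[OF star_linear1]) (simp_all add: poly_series_const polys_var sym_diff_closed mI mult.commute)
  qed
  show ?case
  proof (cases "degm m")
    case 0
    then have "Poly_Mapping.lookup m i = 0" if "i \<in> V" for i
      using that by (simp add: degm_superset[OF assms(1) single] assms(1))
    then show ?thesis unfolding rhs by (simp add: lhs 0)
  next
    case (Suc n)
    have "(\<Sum>i\<in>V. fps_const (var i) \<star> symmetrize (fps_const (partial_deriv i (Poly_Mapping.single m c)))) =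
        cmul c (\<Sum>i\<in>V. cmul (of_nat (Poly_Mapping.lookup m i)) (fps_const (var i) \<star> sym n (?m i)))"
      unfolding sum_distrib_left
    proof (rule sum.cong)
      fix i assume "i \<in> V"
      \<comment> \<open>If x_i does not occur in \<open>m\<close>, the truncated quotient has the
        wrong degree, but its weight is 0.\<close>
      moreover have "degm (?m i) = n" if "Poly_Mapping.lookup m i \<noteq> 0"
        using degm_diff_single[OF that] Suc by simp
      ultimately show "fps_const (var i) \<star> symmetrize (fps_const (partial_deriv i (Poly_Mapping.single m c))) =
          cmul c (cmul (of_nat (Poly_Mapping.lookup m i)) (fps_const (var i) \<star> sym n (?m i)))"
        unfolding lhs[OF \<open>i \<in> V\<close>] by (cases "Poly_Mapping.lookup m i = 0") simp_all
    qed simp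
    also have "\<dots> = cmul (of_nat (degm m) * c) (sym (degm m) m)"
      unfolding sum_star_sym[OF assms(1) single] cmul_cmul Suc by (simp only: mult.commute)
    finally show ?thesis unfolding rhs .
  qed
next
  case (add p q)
  have sI: "symmetrize (fps_const (partial_deriv i r)) \<in> poly_series I"
    and vI: "var i * partial_deriv i r \<in> polys I" if "r \<in> polys V" "i \<in> V" for r i
    using that polys_mono[OF assms(2)] assms(2)
    by (auto intro!: symmetrize_closed poly_series_const polys_partial_deriv polys_mult polys_var)
  have dI: "partial_deriv i r \<in> polys I" if "r \<in> polys V" for r i
    using that polys_mono[OF assms(2)] by (auto intro: polys_partial_deriv)
  have "fps_const (var i) \<star> symmetrize (fps_const (partial_deriv i (p + q))) =
      fps_const (var i) \<star> symmetrize (fps_const (partial_deriv i p)) +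
      fps_const (var i) \<star> symmetrize (fps_const (partial_deriv i q))" if "i \<in> V" for i
  proof -
    have "i \<in> I" using that assms(2) by blast
    then show ?thesis
      using series_linear_add[OF star_linear1[OF poly_series_const[OF polys_var[OF \<open>i \<in> I\<close>]]]
          sI[OF add(1) that] sI[OF add(2) that]]
      by (simp add: symmetrize_const symmetrize_poly_add partial_deriv_add)
  qed
  then show ?case
    using add by (simp add: symmetrize_const symmetrize_poly_add partial_deriv_add sum.distrib distrib_left)
qed

section \<open>The normalised product\<close>

definition normalized_star (infixl "\<star>''" 70) where
  "P \<star>' Q = desymmetrize (symmetrize P \<star> symmetrize Q)"

lemma formal_deformation_normalized_star: "formal_deformation I normalized_star"
  unfolding formal_deformation_def series_bilinear_def
proof (intro conjI ballI)
  fix P Q R :: "('i, 'f) mpoly fps"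
  assume P: "P \<in> poly_series I"
  note SP = symmetrize_closed[OF P]
  show "series_linear I (normalized_star P)"
    unfolding normalized_star_def
    by (rule series_linear_comp[OF desymmetrize_linear series_linear_comp[OF star_linear1[OF SP] symmetrize_linear]])
  show "series_linear I (\<lambda>Q. Q \<star>' P)"
    unfolding normalized_star_def
    by (rule series_linear_comp[OF desymmetrize_linear series_linear_comp[OF star_linear2[OF SP] symmetrize_linear]])
  assume "Q \<in> poly_series I" "R \<in> poly_series I"
  then show "(P \<star>' Q) \<star>' R = P \<star>' (Q \<star>' R)"
    unfolding normalized_star_def
    by (simp add: symmetrize_desymmetrize star_closed symmetrize_closed star_assoc P)
next
  fix p q :: "('i, 'f) mpoly"
  assume p: "p \<in> polys I" and q: "q \<in> polys I"
  let ?R = "symmetrize (fps_const p) \<star> symmetrize (fps_const q)"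
  have R: "?R \<in> poly_series I"
    using p q by (intro star_closed symmetrize_closed poly_series_const)
  then show "(fps_const p \<star>' fps_const q) $ 0 = p * q"
    unfolding normalized_star_def
    by (simp add: series_linear_nth_0[OF desymmetrize_linear R] desymmetrize_nth_0 poly_series_nth[OF R]
        star_nth_0 symmetrize_closed poly_series_const p q symmetrize_const_nth_0 polys_mult)
qed

lemma equivalent_normalized_star: "equivalent_deformations I star normalized_star"
  unfolding equivalent_deformations_def
\<comment> \<open>The equivalence leads from \<star> to the pulled back product, so it is the
  inverse of the symmetrisation.\<close>
proof (intro exI[of _ desymmetrize] conjI ballI desymmetrize_linear desymmetrize_nth_0)
  fix p q :: "('i, 'f) mpoly"
  assume "p \<in> polys I" "q \<in> polys I"
  then show "desymmetrize (fps_const p \<star> fps_const q) = desymmetrize (fps_const p) \<star>' desymmetrize (fps_const q)"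
    by (simp add: normalized_star_def symmetrize_desymmetrize poly_series_const)
qed

lemma differential_operator2_normalized_star: "differential_operator2 I (cochain normalized_star k)"
proof -
  interpret normalized: deformation I normalized_star
    by unfold_locales (fact formal_deformation_normalized_star)
  interpret normalized_cochains I "cochain normalized_star"
  proof
    show "bilinear_on I (cochain normalized_star k)" for k
      by (fact normalized.bilinear_cochain)
    show "cochain normalized_star 0 p q = p * q" if "p \<in> polys I" "q \<in> polys I" for p q
      using that by (rule normalized.cochain_0)
    show "(\<Sum>i\<le>k. cochain normalized_star i (cochain normalized_star (k - i) p q) r) =
        (\<Sum>i\<le>k. cochain normalized_star i p (cochain normalized_star (k - i) q r))"
      if "p \<in> polys I" "q \<in> polys I" "r \<in> polys I" for k p q r
      using that by (rule normalized.cochain_assoc)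
    \<comment> \<open>Symmetrisation sends 1 to the unit of \<star>, so 1 is a unit for the pulled
      back product and has no higher corrections.\<close>
    show "cochain normalized_star k 1 p = 0" if "0 < k" "p \<in> polys I" for k p
    proof -
      have "fps_const 1 \<star>' fps_const p = fps_const p"
        using that by (simp add: normalized_star_def symmetrize_1 unit_left symmetrize_closed
            poly_series_const desymmetrize_symmetrize)
      then show ?thesis using that by (simp add: cochain_def)
    qed
    \<comment> \<open>Symmetrisation fixes variables, so desymmetrising
      \<open>symmetrize_euler\<close> gives a sum without positive powers of h.\<close>
    show "(\<Sum>i\<in>V. cochain normalized_star k (var i) (partial_deriv i p)) = 0"
      if k: "0 < k" and V: "finite V" "V \<subseteq> I" and p: "p \<in> polys V" for k V p
    proof -
      have pI: "p \<in> polys I" using p polys_mono[OF V(2)] by blast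
      have i: "i \<in> I" if "i \<in> V" for i using that V by blast
      have "(\<Sum>i\<in>V. fps_const (var i) \<star>' fps_const (partial_deriv i p)) =
          (\<Sum>i\<in>V. desymmetrize (fps_const (var i) \<star> symmetrize (fps_const (partial_deriv i p))))"
        by (rule sum.cong) (simp_all add: normalized_star_def symmetrize_var i)
      also have "\<dots> = desymmetrize (\<Sum>i\<in>V. fps_const (var i) \<star> symmetrize (fps_const (partial_deriv i p)))"
        by (rule series_linear_sum[OF desymmetrize_linear, symmetric])
           (intro star_closed symmetrize_closed poly_series_const polys_var polys_partial_deriv pI i)
      also have "\<dots> = fps_const (\<Sum>i\<in>V. var i * partial_deriv i p)"
        unfolding symmetrize_euler[OF V p]
        by (intro desymmetrize_symmetrize poly_series_const polys_sum polys_mult polys_var polys_partial_deriv pI i)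
      finally have "(\<Sum>i\<in>V. fps_const (var i) \<star>' fps_const (partial_deriv i p)) $ k = 0"
        using k by simp
      then show ?thesis by (simp add: cochain_def fps_sum_nth)
    qed
  qed
  obtain n where "bidop I n (cochain normalized_star k)" using bidop_cochain by blast
  with normalized.bilinear_cochain show ?thesis by (rule differential_operator2_if_bidop)
qed

text \<open>An average over all orderings may be sorted by the last factor as well as by the first.
  The induction splits off both the first and the last factor and exchanges the two sums.\<close>

lemma sym_Suc_right:
  assumes "Poly_Mapping.keys m \<subseteq> I"
  shows "sym (Suc n) m = cmul (1 / of_nat (Suc n)) (\<Sum>i \<in> Poly_Mapping.keys m.
     cmul (of_nat (Poly_Mapping.lookup m i))
       (sym n (m - Poly_Mapping.single i 1) \<star> fps_const (var i)))"
  using assms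
proof (induction n arbitrary: m)
  case 0
  then have "(fps_const (var i) :: ('i, 'f) mpoly fps) \<in> poly_series I" if "i \<in> Poly_Mapping.keys m" for i
    using that by (auto intro: poly_series_const polys_var)
  then show ?case by (simp add: unit_left unit_right cong: sum.cong)
next
  case (Suc n)
  let ?V = "Poly_Mapping.keys m" and ?x = "\<lambda>i. fps_const (var i) :: ('i, 'f) mpoly fps"
  let ?m = "\<lambda>i. m - Poly_Mapping.single i 1"
  let ?mm = "\<lambda>i j. m - Poly_Mapping.single i 1 - Poly_Mapping.single j 1"
  let ?c = "\<lambda>m i. of_nat (Poly_Mapping.lookup m i) :: 'f"
  have x: "?x i \<in> poly_series I" if "i \<in> ?V" for i
    using that Suc.prems by (auto intro: poly_series_const polys_var)
  have kI: "Poly_Mapping.keys (?m i) \<subseteq> I" for i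
    using order.trans[OF keys_diff_monomial Suc.prems] .
  have s: "sym n (?mm i j) \<in> poly_series I" for i j
    by (rule sym_diff_closed[OF kI])
  have right: "sym (Suc n) (?m i) = cmul (1 / of_nat (Suc n)) (\<Sum>j\<in>?V. cmul (?c (?m i) j) (sym n (?mm i j) \<star> ?x j))" for i
    unfolding Suc.IH[OF kI]
    by (intro arg_cong[of _ _ "cmul _"] sum.mono_neutral_left) (auto simp: in_keys_iff lookup_minus)
  have left: "sym (Suc n) (?m j) = cmul (1 / of_nat (Suc n)) (\<Sum>i\<in>?V. cmul (?c (?m j) i) (?x i \<star> sym n (?mm j i)))" for j
    by (rule sym_Suc_superset) (simp_all add: keys_diff_monomial)
  have mm: "?mm i j = ?mm j i" for i j
    by (rule poly_mapping_eqI) (simp add: lookup_minus)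
  \<comment> \<open>Both sides count the ordered choices of one factor x_i and another factor x_j of
    \<open>m\<close>.\<close>
  have cc: "?c m i * ?c (?m i) j = ?c m j * ?c (?m j) i" for i j
    by (cases "i = j") (simp_all add: lookup_minus lookup_single)
  let ?a = "1 / of_nat (Suc n) :: 'f"
  have "(\<Sum>i\<in>?V. cmul (?c m i) (?x i \<star> sym (Suc n) (?m i))) =
      (\<Sum>i\<in>?V. \<Sum>j\<in>?V. cmul ?a (cmul (?c m i * ?c (?m i) j) (?x i \<star> (sym n (?mm i j) \<star> ?x j))))"
  proof (rule sum.cong)
    fix i assume i: "i \<in> ?V"
    have "?x i \<star> sym (Suc n) (?m i) = cmul ?a (\<Sum>j\<in>?V. cmul (?c (?m i) j) (?x i \<star> (sym n (?mm i j) \<star> ?x j)))"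
      unfolding right
      by (simp only: series_linear_cmul[OF star_linear1[OF x[OF i]]] series_linear_sum[OF star_linear1[OF x[OF i]]]
          poly_series_cmul poly_series_sum star_closed x s cong: sum.cong)
    then show "cmul (?c m i) (?x i \<star> sym (Suc n) (?m i)) =
        (\<Sum>j\<in>?V. cmul ?a (cmul (?c m i * ?c (?m i) j) (?x i \<star> (sym n (?mm i j) \<star> ?x j))))"
      by (simp only: sum_distrib_left cmul_cmul ac_simps)
  qed simp
  also have "\<dots> = (\<Sum>j\<in>?V. \<Sum>i\<in>?V. cmul ?a (cmul (?c m i * ?c (?m i) j) (?x i \<star> (sym n (?mm i j) \<star> ?x j))))"
    by (rule sum.swap)
  also have "\<dots> = (\<Sum>j\<in>?V. \<Sum>i\<in>?V. cmul ?a (cmul (?c m j * ?c (?m j) i) ((?x i \<star> sym n (?mm j i)) \<star> ?x j)))"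
  proof (intro sum.cong refl)
    fix i j assume i: "i \<in> ?V" and j: "j \<in> ?V"
    show "cmul ?a (cmul (?c m i * ?c (?m i) j) (?x i \<star> (sym n (?mm i j) \<star> ?x j))) =
        cmul ?a (cmul (?c m j * ?c (?m j) i) ((?x i \<star> sym n (?mm j i)) \<star> ?x j))"
      unfolding cc[of i j] mm[of i j] star_assoc[OF x[OF i] s x[OF j]] ..
  qed
  also have "\<dots> = (\<Sum>j\<in>?V. cmul (?c m j) (sym (Suc n) (?m j) \<star> ?x j))"
  proof (rule sum.cong)
    fix j assume j: "j \<in> ?V"
    have "sym (Suc n) (?m j) \<star> ?x j = cmul ?a (\<Sum>i\<in>?V. cmul (?c (?m j) i) ((?x i \<star> sym n (?mm j i)) \<star> ?x j))"
      unfolding left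
      by (simp only: series_linear_cmul[OF star_linear2[OF x[OF j]]] series_linear_sum[OF star_linear2[OF x[OF j]]]
          poly_series_cmul poly_series_sum star_closed x s cong: sum.cong)
    then show "(\<Sum>i\<in>?V. cmul ?a (cmul (?c m j * ?c (?m j) i) ((?x i \<star> sym n (?mm j i)) \<star> ?x j))) =
        cmul (?c m j) (sym (Suc n) (?m j) \<star> ?x j)"
      by (simp only: sum_distrib_left cmul_cmul ac_simps)
  qed simp
  finally show ?case by (simp only: sym.simps(2)[of "Suc n"])
qed

section \<open>Quantizations and the anti-automorphism h \<mapsto> -h\<close>

context
  assumes quantization: "deformation_quantization I star"
begin

text \<open>On A this is the parity condition on the cochains. It extends to series in one argument
  at a time.\<close>

lemma hneg_star:
  assumes P: "P \<in> poly_series I" and Q: "Q \<in> poly_series I"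
  shows "hneg (P \<star> Q) = hneg Q \<star> hneg P"
proof -
  have const: "hneg (fps_const p \<star> fps_const q) = fps_const q \<star> fps_const p"
    if p: "p \<in> polys I" and q: "q \<in> polys I" for p q
  proof (rule fps_ext)
    fix k
    have "(even k \<longrightarrow> cochain star k p q = cochain star k q p) \<and>
        (odd k \<longrightarrow> cochain star k p q = - cochain star k q p)"
      using quantization p q unfolding deformation_quantization_def by blast
    then show "hneg (fps_const p \<star> fps_const q) $ k = (fps_const q \<star> fps_const p) $ k"
      unfolding hneg_nth cochain_def by (cases "even k") simp_all
  qed
  \<comment> \<open>The inner \<open>hneg\<close> makes both sides linear in \<open>R\<close>, so
    comparing them on A is enough.\<close>
  have 1: "hneg (fps_const p \<star> hneg R) = R \<star> fps_const p" if "p \<in> polys I" "R \<in> poly_series I" for p R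
    by (rule series_linear_eqI[of I "\<lambda>R. hneg (fps_const p \<star> hneg R)" "\<lambda>R. R \<star> fps_const p"])
       (simp_all add: that const series_linear_hneg star_linear1 star_linear2 poly_series_const)
  have 2: "hneg (hneg R \<star> Q) = hneg Q \<star> R" if "R \<in> poly_series I" for R
  proof (rule series_linear_eqI[of I "\<lambda>R. hneg (hneg R \<star> Q)" "\<lambda>R. hneg Q \<star> R"])
    show "hneg (hneg (fps_const p) \<star> Q) = hneg Q \<star> fps_const p" if "p \<in> polys I" for p
      using 1[OF that poly_series_hneg[OF Q]] by simp
  qed (simp_all add: that Q series_linear_hneg[OF star_linear2[OF Q]] star_linear1 star_linear2 poly_series_hneg)
  show ?thesis using 2[OF poly_series_hneg[OF P]] by simp
qed

text \<open>The product of the unit with its image is computed in two ways: directly, and through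
  the anti-automorphism.\<close>

lemma hneg_unit: "hneg unit = unit"
proof -
  have "hneg (unit \<star> hneg unit) = unit \<star> hneg unit"
    by (simp add: hneg_star unit_closed poly_series_hneg)
  then show ?thesis by (simp add: unit_left unit_closed poly_series_hneg)
qed

text \<open>The anti-automorphism fixes the variables and reverses products, which permutes the
  orderings in the average. Formally, it exchanges the defining recursion with
  \<open>sym_Suc_right\<close>.\<close>

lemma hneg_sym: "Poly_Mapping.keys m \<subseteq> I \<Longrightarrow> hneg (sym n m) = sym n m"
proof (induction n arbitrary: m)
  case 0
  then show ?case by (simp add: hneg_unit)
next
  case (Suc n)
  have "hneg (fps_const (var i) \<star> sym n (m - Poly_Mapping.single i 1)) =
      sym n (m - Poly_Mapping.single i 1) \<star> fps_const (var i)" if "i \<in> Poly_Mapping.keys m" for i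
  proof -
    have "i \<in> I" using that Suc.prems by blast
    then show ?thesis
      using Suc.IH[OF order.trans[OF keys_diff_monomial Suc.prems]]
      by (simp add: hneg_star poly_series_const polys_var sym_diff_closed[OF Suc.prems])
  qed
  then show ?case
    by (subst (2) sym_Suc_right[OF Suc.prems])
       (simp only: sym.simps hneg_mult hneg_sum hneg_const cong: sum.cong)
qed

lemma hneg_symmetrize:
  assumes P: "P \<in> poly_series I"
  shows "hneg (symmetrize P) = symmetrize (hneg P)"
proof -
  have const: "hneg (symmetrize (fps_const p)) = symmetrize (fps_const p)" if "p \<in> polys I" for p
    using that
  proof (induction p rule: polys_induct_single)
    case (single m c)
    then show ?case by (simp add: symmetrize_const symmetrize_poly_single hneg_mult hneg_sym)
  next
    case (add p q)
    then show ?case by (simp add: symmetrize_const symmetrize_poly_add hneg_add)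
  qed
  have "hneg (symmetrize (hneg (hneg P))) = symmetrize (hneg P)"
    by (rule series_linear_eqI[OF series_linear_hneg[OF symmetrize_linear] symmetrize_linear])
       (simp_all add: const poly_series_hneg P)
  then show ?thesis by simp
qed

lemma hneg_desymmetrize:
  assumes P: "P \<in> poly_series I"
  shows "hneg (desymmetrize P) = desymmetrize (hneg P)"
proof -
  have "symmetrize (hneg (desymmetrize P)) = hneg P"
    using hneg_symmetrize[OF desymmetrize_closed[OF P]] by (simp add: symmetrize_desymmetrize P)
  then show ?thesis
    using desymmetrize_symmetrize[OF poly_series_hneg[OF desymmetrize_closed[OF P]]] by simp
qed

text \<open>Symmetrisation and its inverse commute with \<open>hneg\<close>, so the
  anti-automorphism property passes to the pulled back product; its coefficients on A are the parity
  condition again.\<close>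

lemma deformation_quantization_normalized_star: "deformation_quantization I normalized_star"
  unfolding deformation_quantization_def
proof (intro conjI allI ballI formal_deformation_normalized_star)
  fix k and p q :: "('i, 'f) mpoly"
  assume p: "p \<in> polys I" and q: "q \<in> polys I"
  have S: "symmetrize (fps_const r) \<in> poly_series I" "hneg (symmetrize (fps_const r)) = symmetrize (fps_const r)"
    if "r \<in> polys I" for r
    using that by (simp_all add: hneg_symmetrize poly_series_const symmetrize_closed)
  have "hneg (fps_const p \<star>' fps_const q) = fps_const q \<star>' fps_const p"
    unfolding normalized_star_def
    by (simp add: hneg_desymmetrize star_closed S p q hneg_star)
  from arg_cong[OF this, of "\<lambda>P. P $ k"]
  have "cochain normalized_star k q p = (-1) ^ k * cochain normalized_star k p q"
    by (simp add: cochain_def)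
  then show "even k \<longrightarrow> cochain normalized_star k p q = cochain normalized_star k q p"
    and "odd k \<longrightarrow> cochain normalized_star k p q = - cochain normalized_star k q p"
    by simp_all
qed

end

end

theorem theorem4p3:
  fixes I :: "'i set"
  shows
    "(\<forall>star :: ('i, 'f::field_char_0) mpoly fps \<Rightarrow> ('i, 'f) mpoly fps \<Rightarrow> ('i, 'f) mpoly fps.
        formal_deformation I star \<longrightarrow>
        (\<exists>star'. formal_deformation I star' \<and> equivalent_deformations I star star' \<and>
           (\<forall>k. differential_operator2 I (cochain star' k))))
     \<and>
     (\<forall>star :: ('i, 'f) mpoly fps \<Rightarrow> ('i, 'f) mpoly fps \<Rightarrow> ('i, 'f) mpoly fps.
        deformation_quantization I star \<longrightarrow>
        (\<exists>star'. deformation_quantization I star' \<and> equivalent_deformations I star star' \<and>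
           (\<forall>k. differential_operator2 I (cochain star' k))))"
proof (intro conjI allI impI)
  fix star :: "('i, 'f) mpoly fps \<Rightarrow> ('i, 'f) mpoly fps \<Rightarrow> ('i, 'f) mpoly fps"
  assume "formal_deformation I star"
  then interpret deformation I star by unfold_locales
  show "\<exists>star'. formal_deformation I star' \<and> equivalent_deformations I star star' \<and>
      (\<forall>k. differential_operator2 I (cochain star' k))"
    using formal_deformation_normalized_star equivalent_normalized_star
      differential_operator2_normalized_star by blast
next
  fix star :: "('i, 'f) mpoly fps \<Rightarrow> ('i, 'f) mpoly fps \<Rightarrow> ('i, 'f) mpoly fps"
  assume quantization: "deformation_quantization I star"
  then interpret deformation I star
    by unfold_locales (simp add: deformation_quantization_def)
  show "\<exists>star'. deformation_quantization I star' \<and> equivalent_deformations I star star' \<and>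
      (\<forall>k. differential_operator2 I (cochain star' k))"
    using deformation_quantization_normalized_star[OF quantization] equivalent_normalized_star
      differential_operator2_normalized_star by blast
qed

end
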